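(* There is a $7.92$-approximation algorithm for the online stochastic matching problem with edge probabilities and timeouts: its expected revenue is at least $1/7.92$ times the expected revenue of an optimal (adaptive, online) strategy.
   Context: Online stochastic matching with timeouts. The input is a bipartite graph with sides $A$ (items, one copy of each) and $B$ (buyer types); for each $a\in A$, $b\in B$ a probability $p_{ab}\in[0,1]$ and a revenue $w_{ab}\ge0$; for each $b\in B$ a positive integer patience $t_b$ and a nonnegative integer $e_b$, with $\sum_b e_b=n$. All of this is known in advance. Then $n$ buyers arrive one at a time; the type of each is drawn independently from the distribution on $B$ with $\Pr[b]=e_b/n$. When a buyer of type $b$ arrives, the algorithm may show her up to $t_b$ distinct as-yet-unsold items one by one; she likes each shown item $a$ independently with probability $p_{ab}$, buys the first shown item she likes (the algorithm then earns $w_{ab}$ and item $a$ is sold), and stops viewing items; if she likes none, she leaves without buying. The objective is to maximize expected total revenue. The optimum is the best (adaptive, online) strategy, which also learns whether a buyer likes an item only by showing it. *)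

theory Defs
  imports
    "HOL-Probability.Probability"
    "HOL-Computational_Algebra.Polynomial"
    "HOL-Library.Log_Nat"
begin

section \<open>Online stochastic matching with timeouts\<close>

text \<open>
  The items are the numbers below \<open>items I\<close>, the buyer types are the numbers below \<open>types I\<close>;
  the values of the other fields outside these ranges are irrelevant.  The data are rational,
  since they are the input of an algorithm in the bit model of computation.
\<close>

record market =
  items :: nat
  types :: nat
  like_prob :: "nat \<Rightarrow> nat \<Rightarrow> rat"   \<comment> \<open>\<open>like_prob I a b\<close> is $p_{ab}$\<close>
  price :: "nat \<Rightarrow> nat \<Rightarrow> rat"       \<comment> \<open>\<open>price I a b\<close> is $w_{ab}$\<close>
  patience :: "nat \<Rightarrow> nat"
  copies :: "nat \<Rightarrow> nat"             \<comment> \<open>\<open>copies I b\<close> is $e_b$\<close>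

definition valid_market :: "market \<Rightarrow> bool" where
  "valid_market I \<longleftrightarrow>
     (\<forall>a<items I. \<forall>b<types I. 0 \<le> like_prob I a b \<and> like_prob I a b \<le> 1 \<and> 0 \<le> price I a b) \<and>
     (\<forall>b<types I. 0 < patience I b)"

definition buyers :: "market \<Rightarrow> nat" where
  "buyers I = (\<Sum>b<types I. copies I b)"

definition buyer_type :: "market \<Rightarrow> nat pmf" where
  "buyer_type I = pmf_of_multiset (\<Sum>b<types I. replicate_mset (copies I b) b)"

lemma pmf_buyer_type:
  assumes "buyers I > 0"
  shows "pmf (buyer_type I) b = (if b < types I then copies I b / buyers I else 0)"
proof -
  define M where "M = (\<Sum>b<types I. replicate_mset (copies I b) b)"
  have size: "size M = buyers I"
    by (simp add: M_def buyers_def)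
  have count: "count M b = (if b < types I then copies I b else 0)"
    by (simp add: M_def count_sum if_distrib cong: if_cong)
  from assms size have "M \<noteq> {#}"
    by auto
  then have "pmf (buyer_type I) b = count M b / size M"
    unfolding buyer_type_def M_def[symmetric] by (rule pmf_of_multiset)
  then show ?thesis
    by (simp add: size count)
qed

text \<open>
  \<open>Arrives b\<close>: a buyer of type \<open>b\<close> arrives.  \<open>Shown a b l\<close>: item \<open>a\<close> is shown to the current
  buyer, whose type is \<open>b\<close>, and \<open>l\<close> tells whether she likes (and therefore buys) it.
\<close>

datatype event = Arrives nat | Shown nat nat bool

type_synonym history = "event list"   \<comment> \<open>in chronological order\<close>

text \<open>
  A (deterministic, adaptive, online) strategy maps what has been observed so far to the next
  item to be shown to the current buyer; \<open>None\<close> lets her leave.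
\<close>

type_synonym strategy = "history \<Rightarrow> nat option"

definition unsold :: "market \<Rightarrow> history \<Rightarrow> nat set" where
  "unsold I h = {a. a < items I \<and> (\<forall>b. Shown a b True \<notin> set h)}"

text \<open>
  In \<open>serve I \<sigma> b k S h\<close> the current buyer is of type \<open>b\<close>, may still be shown \<open>k\<close> items, and
  \<open>S\<close> is the set of the unsold items that she has not been shown yet.  The attempt to show an
  item outside \<open>S\<close> counts as \<open>None\<close>, so that every function is an admissible strategy.
\<close>

fun serve :: "market \<Rightarrow> strategy \<Rightarrow> nat \<Rightarrow> nat \<Rightarrow> nat set \<Rightarrow> history \<Rightarrow> history pmf" where
  "serve I \<sigma> b 0 S h = return_pmf h"
| "serve I \<sigma> b (Suc k) S h =
     (case \<sigma> h of
        None \<Rightarrow> return_pmf h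
      | Some a \<Rightarrow>
          if a \<in> S then
            bind_pmf (bernoulli_pmf (of_rat (like_prob I a b))) (\<lambda>likes.
              if likes then return_pmf (h @ [Shown a b True])
              else serve I \<sigma> b k (S - {a}) (h @ [Shown a b False]))
          else return_pmf h)"

text \<open>\<open>run I \<sigma> i\<close> is the distribution of the history after \<open>i\<close> buyers.\<close>

fun run :: "market \<Rightarrow> strategy \<Rightarrow> nat \<Rightarrow> history pmf" where
  "run I \<sigma> 0 = return_pmf []"
| "run I \<sigma> (Suc i) =
     bind_pmf (run I \<sigma> i) (\<lambda>h.
     bind_pmf (buyer_type I) (\<lambda>b.
       serve I \<sigma> b (patience I b) (unsold I h) (h @ [Arrives b])))"

fun event_revenue :: "market \<Rightarrow> event \<Rightarrow> real" where
  "event_revenue I (Shown a b True) = of_rat (price I a b)"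
| "event_revenue I _ = 0"

definition revenue :: "market \<Rightarrow> history \<Rightarrow> real" where
  "revenue I h = (\<Sum>x\<leftarrow>h. event_revenue I x)"

text \<open>Randomized strategies are probability distributions on deterministic ones.\<close>

definition expected_revenue :: "market \<Rightarrow> strategy pmf \<Rightarrow> real" where
  "expected_revenue I D =
     measure_pmf.expectation (bind_pmf D (\<lambda>\<sigma>. run I \<sigma> (buyers I))) (revenue I)"

lemma serve_revenue:
  assumes "valid_market I" "b < types I" "h' \<in> set_pmf (serve I \<sigma> b k S h)" "S \<subseteq> {..<items I}"
  shows "revenue I h \<le> revenue I h'"
    and "revenue I h' \<le> revenue I h + (\<Sum>a<items I. \<Sum>b<types I. of_rat (price I a b))"
proof -
  have nonneg: "(0::real) \<le> of_rat (price I a b)" if "a < items I" "b < types I" for a b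
    using assms(1) that by (auto simp: valid_market_def)
  have le: "of_rat (price I a b) \<le> (\<Sum>a<items I. \<Sum>b<types I. of_rat (price I a b) :: real)"
    if "a < items I" for a
  proof -
    have "of_rat (price I a b) \<le> (\<Sum>b<types I. of_rat (price I a b) :: real)"
      using assms(2) that
      by (intro member_le_sum[of b _ "\<lambda>b. of_rat (price I a b) :: real"]) (use nonneg in auto)
    also have "\<dots> \<le> (\<Sum>a<items I. \<Sum>b<types I. of_rat (price I a b) :: real)"
      using that
      by (intro member_le_sum[of a _ "\<lambda>a. \<Sum>b<types I. of_rat (price I a b) :: real"])
         (auto intro!: nonneg sum_nonneg)
    finally show ?thesis .
  qed
  have "revenue I h \<le> revenue I h' \<and>
        revenue I h' \<le> revenue I h + (\<Sum>a<items I. \<Sum>b<types I. of_rat (price I a b))"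
    using assms(3,4)
  proof (induction k arbitrary: S h)
    case 0
    then show ?case by (auto intro!: sum_nonneg nonneg)
  next
    case (Suc k)
    show ?case
    proof (cases "\<exists>a\<in>S. \<sigma> h = Some a")
      case False
      with Suc.prems have "h' = h" by (auto split: option.splits if_splits)
      then show ?thesis by (auto intro!: sum_nonneg nonneg)
    next
      case True
      then obtain a where a: "a \<in> S" "\<sigma> h = Some a" by blast
      with Suc.prems consider "h' = h @ [Shown a b True]"
        | "h' \<in> set_pmf (serve I \<sigma> b k (S - {a}) (h @ [Shown a b False]))"
        by (auto split: if_splits)
      then show ?thesis
      proof cases
        case 1
        with a Suc.prems show ?thesis
          using nonneg[of a b] le[of a] assms(2) by (auto simp: revenue_def)
      next
        case 2
        from Suc.IH[OF 2] Suc.prems(2) show ?thesis by (auto simp: revenue_def)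
      qed
    qed
  qed
  then show "revenue I h \<le> revenue I h'"
    and "revenue I h' \<le> revenue I h + (\<Sum>a<items I. \<Sum>b<types I. of_rat (price I a b))"
    by auto
qed

lemma run_revenue:
  assumes "valid_market I" "buyers I > 0" "h \<in> set_pmf (run I \<sigma> i)"
  shows "0 \<le> revenue I h \<and> revenue I h \<le> i * (\<Sum>a<items I. \<Sum>b<types I. of_rat (price I a b))"
  using assms(3)
proof (induction i arbitrary: h)
  case 0
  then show ?case by (simp add: revenue_def)
next
  case (Suc i)
  then obtain h0 b where h: "h0 \<in> set_pmf (run I \<sigma> i)" "b \<in> set_pmf (buyer_type I)"
      "h \<in> set_pmf (serve I \<sigma> b (patience I b) (unsold I h0) (h0 @ [Arrives b]))"
    by auto
  have "b < types I"
    using h(2) assms(2) by (auto simp: set_pmf_iff pmf_buyer_type split: if_splits)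
  moreover have "unsold I h0 \<subseteq> {..<items I}"
    by (auto simp: unsold_def)
  ultimately show ?case
    using serve_revenue[OF assms(1) _ h(3)] Suc.IH[OF h(1)]
    by (auto simp: revenue_def algebra_simps)
qed

text \<open>Hence \<open>expected_revenue\<close> is the expectation of a bounded random variable.\<close>

lemma integrable_revenue:
  assumes "valid_market I"
  shows "integrable (bind_pmf D (\<lambda>\<sigma>. run I \<sigma> (buyers I))) (revenue I)"
proof (rule measure_pmf.integrable_const_bound)
  have "norm (revenue I h) \<le> real (buyers I) * (\<Sum>a<items I. \<Sum>b<types I. of_rat (price I a b))"
    if "h \<in> set_pmf (run I \<sigma> (buyers I))" for h \<sigma>
  proof (cases "buyers I = 0")
    case True
    with that show ?thesis by (simp add: revenue_def)
  next
    case False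
    with run_revenue[OF assms _ that] show ?thesis by simp
  qed
  then show "AE h in bind_pmf D (\<lambda>\<sigma>. run I \<sigma> (buyers I)). norm (revenue I h)
      \<le> real (buyers I) * (\<Sum>a<items I. \<Sum>b<types I. of_rat (price I a b))"
    by (auto simp: AE_measure_pmf_iff)
qed simp


section \<open>Random access machine with logarithmic cost\<close>

text \<open>
  The programs are structured programs on finitely many arrays of natural numbers; an array is
  named by a number and its cells are indexed by natural numbers.  Each operation is charged the
  binary lengths of the numbers involved in it (cell addresses included), so that running times
  are polynomially related to those of Turing machines.
\<close>

type_synonym store = "nat \<Rightarrow> nat \<Rightarrow> nat"

datatype expr =
    Const nat
  | Get nat expr
  | Add expr expr
  | Monus expr expr
  | Mult expr expr
  | Quot expr expr

datatype com =
    Assign nat expr expr   \<comment> \<open>\<open>Assign x i e\<close> stores \<open>e\<close> in cell \<open>i\<close> of array \<open>x\<close>\<close>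
  | Seq com com
  | If expr com com        \<comment> \<open>a nonzero number is true\<close>
  | While expr com

definition bits :: "nat \<Rightarrow> nat" where
  "bits n = 1 + floorlog 2 n"

fun val :: "expr \<Rightarrow> store \<Rightarrow> nat" where
  "val (Const n) s = n"
| "val (Get x e) s = s x (val e s)"
| "val (Add e f) s = val e s + val f s"
| "val (Monus e f) s = val e s - val f s"
| "val (Mult e f) s = val e s * val f s"
| "val (Quot e f) s = val e s div val f s"

fun cost :: "expr \<Rightarrow> store \<Rightarrow> nat" where
  "cost (Const n) s = bits n"
| "cost (Get x e) s = cost e s + bits (val e s) + bits (val (Get x e) s)"
| "cost (Add e f) s = cost e s + cost f s + bits (val e s) + bits (val f s)"
| "cost (Monus e f) s = cost e s + cost f s + bits (val e s) + bits (val f s)"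
| "cost (Mult e f) s = cost e s + cost f s + bits (val e s) + bits (val f s)"
| "cost (Quot e f) s = cost e s + cost f s + bits (val e s) + bits (val f s)"

text \<open>\<open>exec c s t s'\<close>: started in \<open>s\<close>, the program \<open>c\<close> halts in \<open>s'\<close> at cost \<open>t\<close>.\<close>

inductive exec :: "com \<Rightarrow> store \<Rightarrow> nat \<Rightarrow> store \<Rightarrow> bool" where
  Assign: "exec (Assign x i e) s (cost i s + cost e s + bits (val i s) + bits (val e s))
             (s(x := (s x)(val i s := val e s)))"
| Seq: "exec c s t s' \<Longrightarrow> exec d s' u s'' \<Longrightarrow> exec (Seq c d) s (t + u) s''"
| IfTrue: "val e s \<noteq> 0 \<Longrightarrow> exec c s t s' \<Longrightarrow> exec (If e c d) s (cost e s + t) s'"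
| IfFalse: "val e s = 0 \<Longrightarrow> exec d s t s' \<Longrightarrow> exec (If e c d) s (cost e s + t) s'"
| WhileFalse: "val e s = 0 \<Longrightarrow> exec (While e c) s (cost e s) s"
| WhileTrue: "val e s \<noteq> 0 \<Longrightarrow> exec c s t s' \<Longrightarrow> exec (While e c) s' u s'' \<Longrightarrow>
             exec (While e c) s (cost e s + t + u) s''"

inductive_cases AssignE: "exec (Assign x i e) s t s'"
inductive_cases SeqE: "exec (Seq c d) s t s'"
inductive_cases IfE: "exec (If e c d) s t s'"
inductive_cases WhileE: "exec (While e c) s t s'"

lemma exec_deterministic:
  "exec c s t s' \<Longrightarrow> exec c s u s'' \<Longrightarrow> u = t \<and> s'' = s'"
proof (induction arbitrary: u s'' rule: exec.induct)
  case Assign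
  then show ?case by (rule AssignE) simp
next
  case Seq
  from Seq.prems show ?case by (rule SeqE) (metis Seq.IH)
next
  case IfTrue
  from IfTrue.prems show ?case by (rule IfE) (use IfTrue.hyps(1) in \<open>auto dest: IfTrue.IH\<close>)
next
  case IfFalse
  from IfFalse.prems show ?case by (rule IfE) (use IfFalse.hyps(1) in \<open>auto dest: IfFalse.IH\<close>)
next
  case WhileFalse
  from WhileFalse.prems show ?case by (rule WhileE) (use WhileFalse.hyps in auto)
next
  case WhileTrue
  from WhileTrue.prems show ?case by (rule WhileE) (use WhileTrue.hyps(1) in \<open>auto dest!: WhileTrue.IH\<close>)
qed


section \<open>Polynomial-time online algorithms\<close>

definition encode_rat :: "rat \<Rightarrow> nat list" where   \<comment> \<open>for nonnegative numbers\<close>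
  "encode_rat q = (case quotient_of q of (m, d) \<Rightarrow> [nat m, nat d])"

definition encode_market :: "market \<Rightarrow> nat list" where
  "encode_market I =
     [items I, types I] @
     concat [encode_rat (like_prob I a b) @ encode_rat (price I a b).
               a \<leftarrow> [0..<items I], b \<leftarrow> [0..<types I]] @
     concat [[patience I b, copies I b]. b \<leftarrow> [0..<types I]]"

fun encode_event :: "event \<Rightarrow> nat list" where
  "encode_event (Arrives b) = [0, b, 0]"
| "encode_event (Shown a b l) = [if l then 2 else 1, b, a]"

definition encode_history :: "history \<Rightarrow> nat list" where
  "encode_history h = concat (map encode_event h)"

fun encode_decision :: "nat option \<Rightarrow> nat" where
  "encode_decision None = 0"
| "encode_decision (Some a) = Suc a"

definition encoding_size :: "nat list \<Rightarrow> nat" where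
  "encoding_size xs = (\<Sum>x\<leftarrow>xs. bits x)"

text \<open>
  The numbers in the input are measured in binary, but the \<open>n\<close> arrivals, each of which the
  algorithm has to process, contribute \<open>n\<close>.
\<close>

definition market_size :: "market \<Rightarrow> nat" where
  "market_size I = encoding_size (encode_market I) + buyers I"

definition load :: "nat list \<Rightarrow> nat \<Rightarrow> nat" where
  "load xs i = (if i = 0 then length xs else if i \<le> length xs then xs ! (i - 1) else 0)"

definition input_store :: "market \<Rightarrow> bool list \<Rightarrow> history \<Rightarrow> store" where
  "input_store I r h = (\<lambda>_ _. 0)
     (0 := load (encode_market I),
      1 := load (encode_history h),
      2 := load (map of_bool r))"

text \<open>
  A randomized online algorithm is given as \<open>\<sigma>\<close>, where \<open>\<sigma> I r\<close> is the strategy that it follows in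
  the market \<open>I\<close> if its random bits are \<open>r\<close>.  It draws \<open>poly q (market_size I)\<close> independent fair
  random bits in advance, and computes each of its decisions in polynomial time from the market,
  these bits and the history.  The decision is read off from cell 0 of array 3.
\<close>

type_synonym online_algorithm = "market \<Rightarrow> bool list \<Rightarrow> strategy"

definition poly_time :: "online_algorithm \<Rightarrow> nat poly \<Rightarrow> bool" where
  "poly_time \<sigma> q \<longleftrightarrow>
     (\<exists>(c :: com) (T :: nat poly). \<forall>I r h.
        valid_market I \<and> length r = poly q (market_size I) \<longrightarrow>
        (\<exists>t s. exec c (input_store I r h) t s \<and>
               t \<le> poly T (market_size I + encoding_size (encode_history h)) \<and>
               s 3 0 = encode_decision (\<sigma> I r h)))"

definition randomized_strategy :: "online_algorithm \<Rightarrow> nat poly \<Rightarrow> market \<Rightarrow> strategy pmf" where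
  "randomized_strategy \<sigma> q I =
     map_pmf (\<sigma> I) (pmf_of_set {r. length r = poly q (market_size I)})"

end

theory Submission
  imports Defs
begin

text \<open>
  The algorithm is deterministic and uses no linear program. It computes prices of the items
  backwards in time, starting from 0 after the last buyer. Going back by one buyer, it treats each
  type \<open>b\<close> as follows: with \<open>U = 0\<close> initially, it repeatedly picks a new item \<open>a\<close> that maximizes
  the gain \<open>p\<^sub>a\<^sub>b (w\<^sub>a\<^sub>b - v\<^sub>a - U)\<close>, adds this gain to \<open>U\<close>, and \<open>e\<^sub>b/n\<close> times this gain to the
  price \<open>v\<^sub>a\<close>. A buyer is shown the unsold ones among the picked items, the last pick first.

  Since an item picked later is shown earlier, the picks that are unsold earn at least the sum of
  their gains over the prices. Hence the revenue so far plus the current prices of the unsold items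
  does not decrease in expectation, and the algorithm earns at least the sum of the final prices.
  Conversely, when a buyer of type \<open>b\<close> has arrived, any strategy earns at most the price of the sold
  item plus \<open>U + \<Sum> max 0 (p\<^sub>a\<^sub>b (w\<^sub>a\<^sub>b - v\<^sub>a - U))\<close> over the shown items, and this is at most \<open>2 U\<close>
  by the choice of the picks; summing over the buyers, it earns at most 3 times the sum of the final
  prices. Rounding costs at most as much again, which gives a ratio of 4.
\<close>

section \<open>Bounding the cost of programs\<close>

text \<open>The optimal strategy solves a dynamic program over sets of unsold items; the prices
  replace its value function by an additive one, with one number per item. \<open>U\<close>
  estimates what the list built so far earns from one buyer. It is deducted from a new gain because
  the new item is shown ahead of that list, so its sale forfeits the list. Weighted by e_b/n and
  summed over the types, \<open>U\<close> is what one backward step adds to the prices, up to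
  rounding. Hence both bounds end in the same sum: earnings plus stock, with the stock valued at
  current prices for the algorithm and at the constant final prices for an arbitrary strategy. Exact
  prices would collect new factors in their denominators at every backward step, so prices are kept
  on a fixed grid. This causes an additive error, whereas the claim is multiplicative. The error is
  absorbed by a lower bound on the final prices, valid as soon as some arriving buyer may buy an
  item of positive price; in all other markets every strategy earns nothing.\<close>

fun width :: "expr \<Rightarrow> nat" where
  "width (Const n) = Suc n"
| "width (Get x e) = 1"
| "width (Add e f) = width e + width f"
| "width (Monus e f) = width e"
| "width (Mult e f) = width e + width f"
| "width (Quot e f) = width e"

text \<open>Widths and weights are coefficients of the cell length \<open>L\<close>: values stay
  below \<open>2 ^ (width e * L)\<close> and costs below or at \<open>weight e * L\<close>. Both
  depend on the program text only, so a constant may be charged its value instead of its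
  length.\<close>

fun weight :: "expr \<Rightarrow> nat" where
  "weight (Const n) = 2 * width (Const n)"
| "weight (Get x e) = weight e + 2 * width e + 2"
| "weight (Add e f) = weight e + weight f + 2 * width e + 2 * width f"
| "weight (Monus e f) = weight e + weight f + 2 * width e + 2 * width f"
| "weight (Mult e f) = weight e + weight f + 2 * width e + 2 * width f"
| "weight (Quot e f) = weight e + weight f + 2 * width e + 2 * width f"

fun com_weight :: "com \<Rightarrow> nat" where
  "com_weight (Assign x i e) = weight i + weight e + 2 * width i + 2 * width e"
| "com_weight (Seq c d) = com_weight c + com_weight d"
| "com_weight (If e c d) = weight e + com_weight c + com_weight d"
| "com_weight (While e c) = weight e + com_weight c"

definition bounded_store :: "nat \<Rightarrow> store \<Rightarrow> bool" where
  "bounded_store L s \<longleftrightarrow> 0 < L \<and> (\<forall>x i. s x i < 2 ^ L)"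

lemma width_pos [simp]: "0 < width e"
  by (induction e) auto

lemma less_power_bits: "n < 2 ^ floorlog 2 n"
  using floorlog_bounds[where b = 2 and x = n] by (cases "n = 0") auto

lemma bits_le: "n < 2 ^ k \<Longrightarrow> bits n \<le> Suc k"
  unfolding bits_def using floorlog_leI[of n 2 k] by simp

lemma add_less_power:
  assumes "x < (2::nat) ^ i" "y < 2 ^ j" "0 < i" "0 < j"
  shows "x + y < 2 ^ (i + j)"
proof -
  obtain i' j' where [simp]: "i = Suc i'" "j = Suc j'"
    using assms by (metis gr0_implies_Suc)
  have "x + y + 1 \<le> 2 ^ i + 2 ^ j" using assms by simp
  also have "(2::nat) ^ i + 2 ^ j \<le> 2 ^ (i + j)"
  proof -
    have "2 ^ i' \<le> 2 ^ i' * (2::nat) ^ j'" "2 ^ j' \<le> 2 ^ i' * (2::nat) ^ j'"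
      by auto
    then have "2 * 2 ^ i' + 2 * 2 ^ j' \<le> 4 * (2 ^ i' * (2::nat) ^ j')"
      by linarith
    then show ?thesis by (simp add: power_add)
  qed
  finally show ?thesis by simp
qed

lemma val_less:
  assumes "bounded_store L s"
  shows "val e s < 2 ^ (width e * L)"
proof (induction e)
  case (Const n)
  have "n < 2 ^ Suc n" using less_exp[of "Suc n"] by linarith
  also have "\<dots> \<le> 2 ^ (Suc n * L)"
    using assms mult_le_mono2[of 1 L "Suc n"]
    by (intro power_increasing) (simp_all add: bounded_store_def)
  finally show ?case by simp
next
  case (Get x e)
  then show ?case using assms by (simp add: bounded_store_def)
next
  case (Add e f)
  then show ?case using assms add_less_power
    by (simp add: add_mult_distrib bounded_store_def)
next
  case (Mult e f)
  then show ?case by (simp add: add_mult_distrib power_add mult_strict_mono)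
next
  case (Quot e f)
  then show ?case using le_less_trans[OF div_le_dividend] by simp
qed auto

lemma bits_val:
  assumes "bounded_store L s"
  shows "bits (val e s) \<le> 2 * width e * L"
proof -
  have "bits (val e s) \<le> Suc (width e * L)"
    by (rule bits_le[OF val_less[OF assms]])
  also have "\<dots> \<le> 2 * width e * L"
    using assms width_pos[of e] by (auto simp: bounded_store_def Suc_le_eq)
  finally show ?thesis .
qed

lemma cost_le:
  assumes "bounded_store L s"
  shows "cost e s \<le> weight e * L"
proof (induction e)
  case (Const n)
  then show ?case using bits_val[OF assms, of "Const n"] by simp
next
  case (Get x e)
  then show ?case using bits_val[OF assms, of e] bits_val[OF assms, of "Get x e"]
    by (simp add: algebra_simps)
next
  case (Add e f)
  then show ?case using bits_val[OF assms, of e] bits_val[OF assms, of f]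
    by (simp add: algebra_simps)
next
  case (Monus e f)
  then show ?case using bits_val[OF assms, of e] bits_val[OF assms, of f]
    by (simp add: algebra_simps)
next
  case (Mult e f)
  then show ?case using bits_val[OF assms, of e] bits_val[OF assms, of f]
    by (simp add: algebra_simps)
next
  case (Quot e f)
  then show ?case using bits_val[OF assms, of e] bits_val[OF assms, of f]
    by (simp add: algebra_simps)
qed

text \<open>Here \<open>d\<close> bounds the nesting of the loops, \<open>X\<close> the number of iterations of each of them, and
  \<open>L\<close> the lengths of the stored numbers.\<close>

definition wp :: "nat \<Rightarrow> nat \<Rightarrow> nat \<Rightarrow> com \<Rightarrow> (store \<Rightarrow> bool) \<Rightarrow> store \<Rightarrow> bool" where
  "wp L X d c Q s \<longleftrightarrow> (bounded_store L s \<longrightarrow>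
     (\<exists>t s'. exec c s t s' \<and> t \<le> Suc X ^ d * (com_weight c * L) \<and> bounded_store L s' \<and> Q s'))"

section \<open>Proof rules for total correctness within a time bound\<close>

lemma wp_mono:
  "wp L X d c Q s \<Longrightarrow> (\<And>s'. Q s' \<Longrightarrow> R s') \<Longrightarrow> wp L X d c R s"
  unfolding wp_def by blast

lemma le_Suc_power_mult: "x \<le> y \<Longrightarrow> x \<le> Suc X ^ d * (y::nat)"
  by (metis le_trans mult.commute mult.right_neutral mult_le_mono2 one_le_power Suc_le_eq zero_less_Suc One_nat_def)

lemma wp_Assign:
  assumes "val e s < 2 ^ L" "Q (s(x := (s x)(val i s := val e s)))"
  shows "wp L X d (Assign x i e) Q s"
  unfolding wp_def
proof (intro impI exI conjI)
  assume b: "bounded_store L s"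
  show "exec (Assign x i e) s (cost i s + cost e s + bits (val i s) + bits (val e s))
      (s(x := (s x)(val i s := val e s)))" by (rule exec.Assign)
  show "cost i s + cost e s + bits (val i s) + bits (val e s)
      \<le> Suc X ^ d * (com_weight (Assign x i e) * L)"
    by (rule le_Suc_power_mult)
      (use cost_le[OF b, of i] cost_le[OF b, of e] bits_val[OF b, of i] bits_val[OF b, of e]
       in \<open>simp add: algebra_simps\<close>)
  show "bounded_store L (s(x := (s x)(val i s := val e s)))"
    using b assms(1) by (auto simp: bounded_store_def)
qed (rule assms(2))

lemma wp_Seq:
  assumes "wp L X d c (wp L X d c' Q) s"
  shows "wp L X d (Seq c c') Q s"
  unfolding wp_def
proof
  assume "bounded_store L s"
  with assms obtain t s' where 1: "exec c s t s'" "t \<le> Suc X ^ d * (com_weight c * L)"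
      "bounded_store L s'" "wp L X d c' Q s'"
    unfolding wp_def[of _ _ _ c] by blast
  then obtain u s'' where 2: "exec c' s' u s''" "u \<le> Suc X ^ d * (com_weight c' * L)"
      "bounded_store L s''" "Q s''"
    unfolding wp_def by blast
  have "t + u \<le> Suc X ^ d * (com_weight (Seq c c') * L)"
    using 1(2) 2(2) by (simp add: add_mult_distrib add_mult_distrib2)
  then show "\<exists>t s'. exec (Seq c c') s t s' \<and> t \<le> Suc X ^ d * (com_weight (Seq c c') * L) \<and>
      bounded_store L s' \<and> Q s'"
    using exec.Seq[OF 1(1) 2(1)] 2(3,4) by blast
qed

lemma wp_If:
  assumes "val e s \<noteq> 0 \<Longrightarrow> wp L X d c Q s" "val e s = 0 \<Longrightarrow> wp L X d c' Q s"
  shows "wp L X d (If e c c') Q s"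
  unfolding wp_def
proof
  assume b: "bounded_store L s"
  have e: "cost e s \<le> Suc X ^ d * (weight e * L)"
    by (rule le_Suc_power_mult[OF cost_le[OF b]])
  show "\<exists>t s'. exec (If e c c') s t s' \<and> t \<le> Suc X ^ d * (com_weight (If e c c') * L) \<and>
      bounded_store L s' \<and> Q s'"
  proof (cases "val e s = 0")
    case True
    with assms(2) b obtain t s' where 1: "exec c' s t s'" "t \<le> Suc X ^ d * (com_weight c' * L)"
        "bounded_store L s'" "Q s'"
      unfolding wp_def by blast
    have "cost e s + t \<le> Suc X ^ d * (com_weight (If e c c') * L)"
      using 1(2) e by (simp add: add_mult_distrib add_mult_distrib2)
    then show ?thesis using exec.IfFalse[OF True 1(1)] 1(3,4) by blast
  next
    case False
    with assms(1) b obtain t s' where 1: "exec c s t s'" "t \<le> Suc X ^ d * (com_weight c * L)"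
        "bounded_store L s'" "Q s'"
      unfolding wp_def by blast
    have "cost e s + t \<le> Suc X ^ d * (com_weight (If e c c') * L)"
      using 1(2) e by (simp add: add_mult_distrib add_mult_distrib2)
    then show ?thesis using exec.IfTrue[OF False 1(1)] 1(3,4) by blast
  qed
qed

text \<open>The value of the guard is the number of iterations left, so it doubles as the
  termination measure. The guard is evaluated once more often than the body is run.\<close>

lemma wp_While_count:
  assumes "P i s" "i + k = n" "bounded_store L s"
    and "\<And>i s. P i s \<Longrightarrow> val e s = n - i"
    and "\<And>i s. P i s \<Longrightarrow> i < n \<Longrightarrow> wp L X d c (P (Suc i)) s"
  shows "\<exists>t s'. exec (While e c) s t s' \<and>
    t \<le> Suc k * (weight e * L) + k * (Suc X ^ d * (com_weight c * L)) \<and> bounded_store L s' \<and> P n s'"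
  using assms(1-3)
proof (induction k arbitrary: i s)
  case 0
  then have "val e s = 0" using assms(4) by fastforce
  from exec.WhileFalse[where c=c, OF this] show ?case
    using 0 cost_le[OF 0(3), of e] by fastforce
next
  case (Suc k)
  then have nz: "val e s \<noteq> 0" using assms(4)[of i s] by simp
  from Suc.prems assms(5)[of i s] obtain t s' where 1: "exec c s t s'"
      "t \<le> Suc X ^ d * (com_weight c * L)" "bounded_store L s'" "P (Suc i) s'"
    unfolding wp_def by auto
  from Suc.IH[OF 1(4) _ 1(3)] Suc.prems(2) obtain u s'' where 2: "exec (While e c) s' u s''"
      "u \<le> Suc k * (weight e * L) + k * (Suc X ^ d * (com_weight c * L))"
      "bounded_store L s''" "P n s''"
    by auto
  have "cost e s + t + u
      \<le> Suc (Suc k) * (weight e * L) + Suc k * (Suc X ^ d * (com_weight c * L))"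
    using cost_le[OF Suc.prems(3), of e] 1(2) 2(2) by simp
  then show ?case using exec.WhileTrue[OF nz 1(1) 2(1)] 2(3,4) by blast
qed

text \<open>With at most \<open>X\<close> runs of the body and \<open>X + 1\<close> evaluations of
  the guard, one more level of nesting costs one more factor \<open>Suc X\<close>.\<close>

lemma wp_While:
  assumes "P 0 s" "n \<le> X"
    and "\<And>i s. P i s \<Longrightarrow> val e s = n - i"
    and "\<And>i s. P i s \<Longrightarrow> i < n \<Longrightarrow> wp L X d c (P (Suc i)) s"
  shows "wp L X (Suc d) (While e c) (P n) s"
  unfolding wp_def
proof
  assume "bounded_store L s"
  from wp_While_count[of P 0, OF assms(1) _ this assms(3,4)] obtain t s' where
    1: "exec (While e c) s t s'"
      "t \<le> Suc n * (weight e * L) + n * (Suc X ^ d * (com_weight c * L))"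
      "bounded_store L s'" "P n s'"
    by auto
  have "Suc n * (weight e * L) \<le> Suc X * (Suc X ^ d * (weight e * L))"
    using assms(2) by (intro mult_le_mono le_Suc_power_mult) auto
  moreover have "n * (Suc X ^ d * (com_weight c * L)) \<le> Suc X * (Suc X ^ d * (com_weight c * L))"
    using assms(2) by (intro mult_le_mono) auto
  ultimately have "t \<le> Suc X ^ Suc d * (com_weight (While e c) * L)"
    using 1(2) by (simp add: algebra_simps)
  with 1 show "\<exists>t s'. exec (While e c) s t s' \<and> t \<le> Suc X ^ Suc d * (com_weight (While e c) * L) \<and>
      bounded_store L s' \<and> P n s'" by blast
qed

section \<open>Counting loops\<close>

abbreviation Var :: "nat \<Rightarrow> expr" where
  "Var x \<equiv> Get x (Const 0)"

abbreviation Set :: "nat \<Rightarrow> expr \<Rightarrow> com" where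
  "Set x \<equiv> Assign x (Const 0)"

text \<open>The bound \<open>e\<close> is evaluated anew in each iteration; truncated subtraction
  turns the guard into the number of iterations left, as \<open>wp_While\<close> expects.\<close>

definition For :: "nat \<Rightarrow> expr \<Rightarrow> com \<Rightarrow> com" where
  "For x e c = Seq (Set x (Const 0))
     (While (Monus e (Var x)) (Seq c (Set x (Add (Var x) (Const 1)))))"

text \<open>The body has to establish the next invariant for the state in which the counter is
  already advanced, while leaving the counter itself alone. \<open>n < 2 ^ L\<close> lets the
  counter fit into its cell.\<close>

lemma wp_For:
  assumes "P 0 (s(x := (s x)(0 := 0)))" "n \<le> X" "n < 2 ^ L"
    and "\<And>i s. P i s \<Longrightarrow> val e s = n"
    and "\<And>i s. P i s \<Longrightarrow> s x 0 = i \<Longrightarrow> i < n \<Longrightarrow>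
           wp L X d c (\<lambda>s. s x 0 = i \<and> P (Suc i) (s(x := (s x)(0 := Suc i)))) s"
  shows "wp L X (Suc d) (For x e c) (P n) s"
  unfolding For_def
proof (rule wp_Seq, rule wp_Assign)
  let ?P = "\<lambda>i s. P i s \<and> s x 0 = i"
  have "wp L X (Suc d) (While (Monus e (Var x)) (Seq c (Set x (Add (Var x) (Const 1))))) (?P n)
      (s(x := (s x)(0 := 0)))"
  proof (rule wp_While)
    fix i s assume i: "?P i s" "i < n"
    then have "wp L X d c (\<lambda>s. s x 0 = i \<and> P (Suc i) (s(x := (s x)(0 := Suc i)))) s"
      using assms(5) by simp
    then show "wp L X d (Seq c (Set x (Add (Var x) (Const 1)))) (?P (Suc i)) s"
      by (intro wp_Seq, elim wp_mono, intro wp_Assign) (use i assms(3) in auto)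
  qed (use assms in \<open>auto simp del: fun_upd_apply simp: fun_upd_same\<close>)
  then show "wp L X (Suc d) (While (Monus e (Var x)) (Seq c (Set x (Add (Var x) (Const 1))))) (P n)
      (s(x := (s x)(val (Const 0) s := val (Const 0) s)))"
    unfolding val.simps by (rule wp_mono) simp
qed simp

section \<open>Greedy prices\<close>

definition numer :: "rat \<Rightarrow> nat" where
  "numer q = nat (fst (quotient_of q))"

definition denom :: "rat \<Rightarrow> nat" where
  "denom q = nat (snd (quotient_of q))"

lemma denom_pos: "0 < denom q"
  unfolding denom_def using quotient_of_denom_pos' by simp

lemma of_rat_numer_denom:
  assumes "0 \<le> q"
  shows "of_rat q = real (numer q) / real (denom q)"
proof -
  obtain a b where ab: "quotient_of q = (a, b)" by (cases "quotient_of q")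
  have "0 < b" using quotient_of_denom_pos[OF ab] .
  moreover have q: "q = of_int a / of_int b" using quotient_of_div[OF ab] .
  ultimately have "0 \<le> a" using assms by (simp add: zero_le_divide_iff)
  with \<open>0 < b\<close> have "real_of_int a / real_of_int b = real (numer q) / real (denom q)"
    by (simp add: numer_def denom_def ab)
  then show ?thesis by (simp add: q of_rat_divide)
qed

text \<open>A number, computable in one pass over the input, that exceeds the number of buyers and
  every number in the encoding (\<open>buyers_less_scale\<close>, \<open>scale_ge_elem\<close>), yet
  is at most \<open>2 ^ market_size I\<close> (\<open>scale_le\<close>), so that its powers have
  polynomial length.\<close>

definition market_scale :: "market \<Rightarrow> nat" where
  "market_scale I = (1 + buyers I) * (\<Prod>x\<leftarrow>encode_market I. 1 + x)"

text \<open>Prices are rounded to multiples of \<open>1 / market_scale I ^ 10\<close>; this exponent makes the total rounding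
  error smaller than the final sum of the item prices, see \<open>prices_large\<close> below.\<close>

definition scaled_price :: "market \<Rightarrow> nat \<Rightarrow> nat \<Rightarrow> nat" where
  "scaled_price I a b = market_scale I ^ 10 * numer (price I a b) div denom (price I a b)"

text \<open>Truncated subtraction yields gain 0 when price and \<open>U\<close> leave no surplus, so
  a positive gain by itself certifies a worthwhile pick.\<close>

definition gain :: "market \<Rightarrow> nat \<Rightarrow> (nat \<Rightarrow> nat) \<Rightarrow> nat \<Rightarrow> nat \<Rightarrow> nat" where
  "gain I b v U a =
     numer (like_prob I a b) * (scaled_price I a b - v a - U) div denom (like_prob I a b)"

text \<open>The comparison is strict and starts from 0: a maximum 0 says that there is no positive
  value, and the position then carries no information.\<close>

fun scan :: "(nat \<Rightarrow> nat) \<Rightarrow> nat \<Rightarrow> nat \<times> nat" where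
  "scan f 0 = (0, 0)"
| "scan f (Suc a) = (if fst (scan f a) < f a then (f a, a) else scan f a)"

text \<open>The item prices, the value of the list picked so far for the current type, and this list in the
  order in which it will be shown: the item picked last comes first.\<close>

type_synonym progress = "(nat \<Rightarrow> nat) \<times> nat \<times> nat list"

definition pick :: "market \<Rightarrow> nat \<Rightarrow> progress \<Rightarrow> progress" where
  "pick I b = (\<lambda>(v, U, L).
     let (x, a) = scan (\<lambda>a. if a \<in> set L then 0 else gain I b v U a) (items I)
     in if x = 0 then (v, U, L)
        else (v(a := v a + copies I b * x div buyers I), U + x, a # L))"

definition greedy :: "market \<Rightarrow> nat \<Rightarrow> (nat \<Rightarrow> nat) \<Rightarrow> nat \<Rightarrow> progress" where
  "greedy I b v k = (pick I b ^^ k) (v, 0, [])"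

definition picks :: "market \<Rightarrow> nat \<Rightarrow> nat" where
  "picks I b = min (items I) (patience I b)"

text \<open>The prices are updated in place, so a type sees the increases made for smaller types.
  Both bounds tolerate this because prices only grow.\<close>

fun prices_within :: "market \<Rightarrow> (nat \<Rightarrow> nat) \<Rightarrow> nat \<Rightarrow> nat \<Rightarrow> nat" where
  "prices_within I v 0 = v"
| "prices_within I v (Suc b) = fst (greedy I b (prices_within I v b) (picks I b))"

fun prices :: "market \<Rightarrow> nat \<Rightarrow> nat \<Rightarrow> nat" where
  "prices I 0 = (\<lambda>_. 0)"
| "prices I (Suc j) = prices_within I (prices I j) (types I)"

text \<open>\<open>j\<close> is the number of buyers still to come after the current one.\<close>

definition showlist :: "market \<Rightarrow> nat \<Rightarrow> nat \<Rightarrow> nat list" where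
  "showlist I j b = snd (snd (greedy I b (prices_within I (prices I j) b) (picks I b)))"

section \<open>Invariants of the greedy selection\<close>

lemma scan_max: "a < m \<Longrightarrow> f a \<le> fst (scan f m)"
  by (induction m) (auto simp: less_Suc_eq not_less intro: order_trans less_imp_le)

lemma scan_arg: "fst (scan f m) \<noteq> 0 \<Longrightarrow> snd (scan f m) < m \<and> f (snd (scan f m)) = fst (scan f m)"
  by (induction m) (auto split: if_splits)

lemma greedy_0: "greedy I b v 0 = (v, 0, [])"
  by (simp add: greedy_def)

lemma greedy_Suc: "greedy I b v (Suc k) = pick I b (greedy I b v k)"
  by (simp add: greedy_def)

lemma pick_cases:
  obtains
    (none) "pick I b (v, U, L) = (v, U, L)"
      "\<And>a. a < items I \<Longrightarrow> a \<notin> set L \<Longrightarrow> gain I b v U a = 0"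
  | (some) a where "pick I b (v, U, L) =
        (v(a := v a + copies I b * gain I b v U a div buyers I), U + gain I b v U a, a # L)"
      "a < items I" "a \<notin> set L" "0 < gain I b v U a"
      "\<And>a'. a' < items I \<Longrightarrow> a' \<notin> set L \<Longrightarrow> gain I b v U a' \<le> gain I b v U a"
proof -
  define f where "f = (\<lambda>a. if a \<in> set L then 0 else gain I b v U a)"
  obtain x a where xa: "scan f (items I) = (x, a)" by (cases "scan f (items I)")
  have max: "f a' \<le> x" if "a' < items I" for a'
    using scan_max[OF that, of f] xa by simp
  show thesis
  proof (cases "x = 0")
    case True
    show thesis
    proof (rule none)
      show "pick I b (v, U, L) = (v, U, L)"
        using xa True by (simp add: pick_def f_def)
      show "gain I b v U a = 0" if "a < items I" "a \<notin> set L" for a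
        using max[of a] that True by (simp add: f_def)
    qed
  next
    case False
    with scan_arg[of f "items I"] xa have a: "a < items I" "f a = x" by auto
    with False have nL: "a \<notin> set L" and g: "gain I b v U a = x"
      by (auto simp: f_def split: if_splits)
    show thesis
    proof (rule some[of a])
      show "pick I b (v, U, L) =
        (v(a := v a + copies I b * gain I b v U a div buyers I), U + gain I b v U a, a # L)"
        using xa False g by (simp add: pick_def f_def)
      show "gain I b v U a' \<le> gain I b v U a" if "a' < items I" "a' \<notin> set L" for a'
        using max[of a'] that g by (simp add: f_def)
    qed (use a nL g False in auto)
  qed
qed

lemma buyer_copies_le: "b < types I \<Longrightarrow> copies I b \<le> buyers I"
  unfolding buyers_def by (rule member_le_sum) auto

text \<open>A price moves only when its item is picked, so the gains of items not yet picked still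
  refer to the initial prices.\<close>

lemma greedy_basic:
  assumes "greedy I b v0 k = (v, U, L)"
  shows "length L \<le> k" "distinct L" "set L \<subseteq> {..<items I}" "a \<notin> set L \<Longrightarrow> v a = v0 a" "v0 a \<le> v a"
proof -
  have "length L \<le> k \<and> distinct L \<and> set L \<subseteq> {..<items I} \<and> (\<forall>a. a \<notin> set L \<longrightarrow> v a = v0 a) \<and>
      (\<forall>a. v0 a \<le> v a)"
    using assms
  proof (induction k arbitrary: v U L)
    case (Suc k)
    obtain v' U' L' where g: "greedy I b v0 k = (v', U', L')" by (metis prod_cases3)
    note IH = Suc.IH[OF g]
    show ?case
      by (rule pick_cases[of I b v' U' L'])
        (use Suc.prems IH in \<open>auto simp: greedy_Suc g intro: trans_le_add1\<close>)
  qed (simp add: greedy_0)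
  then show "length L \<le> k" "distinct L" "set L \<subseteq> {..<items I}" "a \<notin> set L \<Longrightarrow> v a = v0 a" "v0 a \<le> v a"
    by blast+
qed

definition likes :: "market \<Rightarrow> nat \<Rightarrow> nat \<Rightarrow> real" where
  "likes I a b = of_rat (like_prob I a b)"

lemma likes_nonneg: "valid_market I \<Longrightarrow> a < items I \<Longrightarrow> b < types I \<Longrightarrow> 0 \<le> likes I a b"
  and likes_le_1: "valid_market I \<Longrightarrow> a < items I \<Longrightarrow> b < types I \<Longrightarrow> likes I a b \<le> 1"
  by (auto simp: likes_def valid_market_def)

text \<open>Rounding down loses less than 1. The second bound asks for a positive gain because the
  untruncated surplus may be negative. The third uses that probabilities are at most 1; it later
  keeps prices from outgrowing the scaled prices.\<close>

lemma gain_bounds: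
  assumes "valid_market I" "a < items I" "b < types I"
  shows "likes I a b * (real (scaled_price I a b) - v a - U) < real (gain I b v U a) + 1"
    and "0 < gain I b v U a \<Longrightarrow>
         gain I b v U a \<le> likes I a b * (real (scaled_price I a b) - v a - U)"
    and "gain I b v U a \<le> scaled_price I a b - v a - U"
proof -
  define r where "r = scaled_price I a b - v a - U"
  define p where "p = numer (like_prob I a b)"
  define d where "d = denom (like_prob I a b)"
  have d: "0 < d" by (simp add: d_def denom_pos)
  have l: "likes I a b = real p / real d"
    using assms by (simp add: likes_def p_def d_def of_rat_numer_denom valid_market_def)
  have g: "gain I b v U a = p * r div d"
    by (simp add: gain_def r_def p_def d_def)
  have p: "p \<le> d"
    using likes_le_1[OF assms] d by (simp add: l)
  have le: "real (p * r div d) \<le> likes I a b * r"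
    using of_nat_div_le_of_nat[of "p * r" d, where 'a=real] by (simp add: l)
  have gt: "likes I a b * r < real (p * r div d) + 1"
  proof -
    have "p * r < (p * r div d + 1) * d"
      using d by (metis add.commute dividend_less_times_div mult.commute plus_1_eq_Suc mult_Suc)
    then have "real (p * r) < real ((p * r div d + 1) * d)"
      by (rule of_nat_less_iff[THEN iffD2])
    then show ?thesis using d by (simp add: l field_simps)
  qed
  show "likes I a b * (real (scaled_price I a b) - v a - U) < real (gain I b v U a) + 1"
  proof -
    have "likes I a b * (real (scaled_price I a b) - v a - U) \<le> likes I a b * r"
      by (intro mult_left_mono likes_nonneg assms) (simp add: r_def)
    then show ?thesis using gt g by simp
  qed
  show "gain I b v U a \<le> likes I a b * (real (scaled_price I a b) - v a - U)"
    if "0 < gain I b v U a"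
  proof -
    have "r \<noteq> 0" using that g by (intro notI) simp
    then have "real r = real (scaled_price I a b) - v a - U" by (simp add: r_def)
    then show ?thesis using le g by simp
  qed
  have "p * r div d \<le> d * r div d" by (intro div_le_mono mult_le_mono p) simp
  then show "gain I b v U a \<le> scaled_price I a b - v a - U"
    using d g by (simp add: r_def)
qed

lemma div_upper: "0 < n \<Longrightarrow> real x \<le> real n * real (x div n + 1)"
  by (metis add.commute dividend_less_times_div less_imp_le mult_Suc_right of_nat_le_iff of_nat_mult plus_1_eq_Suc)

text \<open>The expected reward from one buyer who is shown the list in order until she likes an
  item, where selling \<open>a\<close> is rewarded by \<open>r a\<close>.\<close>

fun list_value :: "(nat \<Rightarrow> real) \<Rightarrow> (nat \<Rightarrow> real) \<Rightarrow> nat list \<Rightarrow> real" where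
  "list_value p r [] = 0"
| "list_value p r (a # L) = p a * r a + (1 - p a) * list_value p r L"

text \<open>\<open>X\<close> stands for the unsold items. Each gain was reduced by the
  \<open>U\<close> of all earlier picks, sold ones included, so omitting the sold ones does no harm:
  \<open>S\<close> accumulates the gains of the picks in \<open>X\<close> only, and
  \<open>S \<le> U\<close> bounds the next gain by the surplus over \<open>S\<close>. The prices
  \<open>y\<close> may lie below \<open>v0\<close> because the list is later valued at prices from
  before the smaller types were treated.\<close>

lemma greedy_list_value:
  assumes "valid_market I" "b < types I" "0 < buyers I" "greedy I b v0 k = (v, U, L)"
    and y: "\<And>a. y a \<le> real (v0 a)" and fin: "finite X"
  shows "(\<Sum>a\<in>X. real (v a) - real (v0 a)) * buyers I \<le>
    copies I b * list_value (\<lambda>a. likes I a b) (\<lambda>a. real (scaled_price I a b) - y a) (filter (\<lambda>a. a \<in> X) L)"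
    (is "_ \<le> _ * ?val L")
proof -
  have "\<exists>S::real. (\<Sum>a\<in>X. real (v a) - real (v0 a)) * buyers I \<le> real (copies I b) * S \<and> S \<le> real U \<and> S \<le> ?val L"
    using assms(4)
  proof (induction k arbitrary: v U L)
    case 0
    then show ?case by (intro exI[of _ 0]) (simp add: greedy_0)
  next
    case (Suc k)
    obtain v' U' L' where g: "greedy I b v0 k = (v', U', L')" by (metis prod_cases3)
    from Suc.IH[OF g] obtain S where S: "(\<Sum>a\<in>X. real (v' a) - real (v0 a)) * buyers I \<le> real (copies I b) * S"
        "S \<le> real U'" "S \<le> ?val L'" by blast
    show ?case
    proof (cases rule: pick_cases[of I b v' U' L'])
      case 1: none
      then show ?thesis using S Suc.prems by (auto simp: greedy_Suc g)
    next
      case 2: (some a)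
      define x where "x = gain I b v' U' a"
      have v: "v = v'(a := v' a + copies I b * x div buyers I)" and U: "U = U' + x" and L: "L = a # L'"
        using Suc.prems 2(1) by (auto simp: greedy_Suc g x_def)
      show ?thesis
      proof (cases "a \<in> X")
        case False
        then have "(\<Sum>a\<in>X. real (v a) - real (v0 a)) = (\<Sum>a\<in>X. real (v' a) - real (v0 a))"
          by (intro sum.cong) (auto simp: v)
        with S False show ?thesis by (auto simp: U L)
      next
        case True
        have sum: "(\<Sum>a\<in>X. real (v a) - real (v0 a)) =
            (\<Sum>a\<in>X. real (v' a) - real (v0 a)) + real (copies I b * x div buyers I)"
          using fin True by (simp add: sum.remove[of X a] v)
        have "real (copies I b * x div buyers I) * buyers I \<le> copies I b * real x"
          by (metis div_times_less_eq_dividend of_nat_le_iff of_nat_mult)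
        with S(1) sum have 1: "(\<Sum>a\<in>X. real (v a) - real (v0 a)) * buyers I \<le> copies I b * (S + x)"
          by (simp add: algebra_simps)
        let ?p = "likes I a b" and ?w = "real (scaled_price I a b)"
        have p: "0 \<le> ?p" "?p \<le> 1"
          using likes_nonneg likes_le_1 assms(1,2) 2(2) by auto
        have "real x \<le> ?p * (?w - v' a - U')"
          using gain_bounds(2)[OF assms(1) 2(2) assms(2), of v' U'] 2(4) by (simp add: x_def)
        also have "\<dots> \<le> ?p * (?w - y a - S)"
          using y[of a] greedy_basic(5)[OF g, of a] S(2) by (intro mult_left_mono p) linarith
        \<comment> \<open>The right-hand side has the shape of \<open>list_value\<close> for
          \<open>a # L'\<close>: the new pick is shown first, and if it is declined the older picks
          still earn at least \<open>S\<close>.\<close>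
        finally have "S + x \<le> ?p * (?w - y a) + (1 - ?p) * S" by (simp add: algebra_simps)
        also have "\<dots> \<le> ?p * (?w - y a) + (1 - ?p) * ?val L'"
          using S(3) p by (intro add_left_mono mult_left_mono) auto
        finally have 3: "S + x \<le> ?val L" using True by (simp add: L)
        show ?thesis using 1 3 S(2) by (intro exI[of _ "S + x"]) (simp add: U)
      qed
    qed
  qed
  then show ?thesis by (meson mult_left_mono of_nat_0_le_iff order_trans)
qed

text \<open>The accounting in the other direction: a pick that adds \<open>x\<close> to
  \<open>U\<close> adds \<open>copies I b * x / buyers I\<close> to a price, less a rounding loss
  below 1, and there are at most \<open>k\<close> picks.\<close>

lemma greedy_upper:
  assumes "valid_market I" "b < types I" "0 < buyers I" "greedy I b v0 k = (v, U, L)"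
  shows "copies I b * real U \<le> buyers I * ((\<Sum>a<items I. real (v a) - real (v0 a)) + k)"
  using assms(4)
proof (induction k arbitrary: v U L)
  case 0
  then show ?case by (simp add: greedy_0)
next
  case (Suc k)
  obtain v' U' L' where g: "greedy I b v0 k = (v', U', L')" by (metis prod_cases3)
  note IH = Suc.IH[OF g]
  show ?case
  proof (cases rule: pick_cases[of I b v' U' L'])
    case 1: none
    then have "v = v'" "U = U'" using Suc.prems by (auto simp: greedy_Suc g)
    with IH show ?thesis by (simp add: algebra_simps)
  next
    case 2: (some a)
    define x where "x = gain I b v' U' a"
    have v: "v = v'(a := v' a + copies I b * x div buyers I)" and U: "U = U' + x" and L: "L = a # L'"
      using Suc.prems 2(1) by (auto simp: greedy_Suc g x_def)
    have sum: "(\<Sum>a<items I. real (v a) - real (v0 a)) =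
        (\<Sum>a<items I. real (v' a) - real (v0 a)) + real (copies I b * x div buyers I)"
      using 2(2) by (simp add: sum.remove[of "{..<items I}" a] v)
    have "real (copies I b * x) \<le> buyers I * real (copies I b * x div buyers I + 1)"
      by (rule div_upper[OF assms(3)])
    then show ?thesis using IH unfolding sum U by (simp add: algebra_simps)
  qed
qed

text \<open>Every pick loses less than 1 by rounding, hence the summand \<open>k\<close>.\<close>

lemma greedy_surplus:
  assumes "valid_market I" "b < types I" "greedy I b v0 k = (v, U, L)" "real U \<le> u"
    and "A \<subseteq> {..<items I}" "card A \<le> k"
  shows "(\<Sum>a\<in>A. max 0 (likes I a b * (real (scaled_price I a b) - v0 a - u))) \<le> real U + k"
  using assms(3-6)
proof (induction k arbitrary: v U L A)
  case 0
  then have "A = {}" using finite_subset[OF 0(3)] by simp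
  then show ?case by simp
next
  case (Suc k)
  let ?f = "\<lambda>a. max 0 (likes I a b * (real (scaled_price I a b) - v0 a - u))"
  have fin: "finite A" using Suc.prems(3) finite_subset by blast
  obtain v' U' L' where g: "greedy I b v0 k = (v', U', L')" by (metis prod_cases3)
  define x where "x = U - U'"
  have x: "U = U' + x" and max: "\<And>a. a < items I \<Longrightarrow> a \<notin> set L' \<Longrightarrow> gain I b v' U' a \<le> x"
    by (atomize(full), rule pick_cases[of I b v' U' L'])
      (use Suc.prems in \<open>auto simp: greedy_Suc g x_def\<close>)
  have U': "real U' \<le> u" using Suc.prems(2) x by simp
  \<comment> \<open>If all of \<open>A\<close> was picked before, then \<open>A\<close> has at most
    \<open>k\<close> elements and the induction hypothesis applies to \<open>A\<close> itself.
    Otherwise some item of \<open>A\<close> competed with the latest pick, so its summand is at most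
    \<open>x + 1\<close>, and the induction hypothesis covers the rest.\<close>
  show ?case
  proof (cases "A \<subseteq> set L'")
    case True
    then have "card A \<le> k"
      using card_mono[of "set L'" A] card_length[of L'] greedy_basic(1)[OF g] by simp
    from Suc.IH[OF g U' Suc.prems(3) this] show ?thesis using x by simp
  next
    case False
    then obtain a where a: "a \<in> A" "a \<notin> set L'" by blast
    then have am: "a < items I" using Suc.prems(3) by auto
    have "(\<Sum>a\<in>A - {a}. ?f a) \<le> real U' + k"
      by (rule Suc.IH[OF g U']) (use Suc.prems a fin in auto)
    moreover have "?f a \<le> x + 1"
    proof -
      have "likes I a b * (real (scaled_price I a b) - v0 a - u)
          \<le> likes I a b * (real (scaled_price I a b) - v' a - U')"
        using greedy_basic(4)[OF g a(2)] U' likes_nonneg[OF assms(1) am assms(2)]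
        by (intro mult_left_mono) auto
      also have "\<dots> < real (gain I b v' U' a) + 1"
        by (rule gain_bounds(1)[OF assms(1) am assms(2)])
      also have "real (gain I b v' U' a) + 1 \<le> x + 1" using max[OF am a(2)] by simp
      finally show ?thesis by simp
    qed
    ultimately show ?thesis using x a fin by (simp add: sum.remove[of A a])
  qed
qed

section \<open>Expected revenue\<close>

lemma expectation_bind_finite:
  fixes g :: "'b \<Rightarrow> real"
  assumes "finite (set_pmf p)" "\<And>x. x \<in> set_pmf p \<Longrightarrow> finite (set_pmf (f x))"
  shows "measure_pmf.expectation (bind_pmf p f) g =
    measure_pmf.expectation p (\<lambda>x. measure_pmf.expectation (f x) g)"
  using assms
  by (simp add: pmf_expectation_bind[where A = "set_pmf p"] integral_measure_pmf[where A = "set_pmf p"])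

lemma expectation_mono_finite:
  fixes f g :: "'a \<Rightarrow> real"
  assumes "finite (set_pmf p)" "\<And>x. x \<in> set_pmf p \<Longrightarrow> f x \<le> g x"
  shows "measure_pmf.expectation p f \<le> measure_pmf.expectation p g"
  by (rule integral_mono_AE) (use assms in \<open>auto simp: integrable_measure_pmf_finite AE_measure_pmf_iff\<close>)

lemma set_buyer_type: "0 < buyers I \<Longrightarrow> set_pmf (buyer_type I) = {b. b < types I \<and> 0 < copies I b}"
  by (auto simp: set_pmf_iff pmf_buyer_type split: if_splits)

lemma expectation_buyer_type:
  assumes "0 < buyers I"
  shows "measure_pmf.expectation (buyer_type I) f = (\<Sum>b<types I. copies I b / buyers I * (f b :: real))"
  using assms
  by (subst integral_measure_pmf[where A = "{..<types I}"])
    (auto simp: set_buyer_type pmf_buyer_type intro!: sum.cong)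

lemma finite_serve [simp]: "finite (set_pmf (serve I \<sigma> b k S h))"
proof (induction k arbitrary: S h)
  case (Suc k)
  then show ?case by (auto split: option.splits if_splits)
qed simp

lemma finite_run: "0 < buyers I \<Longrightarrow> finite (set_pmf (run I \<sigma> i))"
  by (induction i) (auto simp: set_buyer_type)

lemma expectation_run_Suc:
  assumes "0 < buyers I"
  shows "measure_pmf.expectation (run I \<sigma> (Suc i)) f =
    measure_pmf.expectation (run I \<sigma> i) (\<lambda>h. \<Sum>b<types I. copies I b / buyers I *
      measure_pmf.expectation (serve I \<sigma> b (patience I b) (unsold I h) (h @ [Arrives b])) f :: real)"
  using assms
  by (simp add: expectation_bind_finite expectation_buyer_type finite_run set_buyer_type)

lemma sum_copies: "0 < buyers I \<Longrightarrow> (\<Sum>b<types I. copies I b / buyers I * (c::real)) = c"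
proof -
  assume "0 < buyers I"
  then have "(\<Sum>b<types I. copies I b / buyers I) = (1::real)"
    by (simp flip: sum_divide_distrib of_nat_sum buyers_def)
  then show ?thesis by (simp only: mult_1_left flip: sum_distrib_right)
qed

lemma expectation_serve_Some:
  assumes "valid_market I" "a < items I" "b < types I" "\<sigma> h = Some a" "a \<in> S"
  shows "measure_pmf.expectation (serve I \<sigma> b (Suc k) S h) f =
    likes I a b * f (h @ [Shown a b True]) +
    (1 - likes I a b) * (measure_pmf.expectation (serve I \<sigma> b k (S - {a}) (h @ [Shown a b False])) f :: real)"
  using assms likes_nonneg[OF assms(1-3)] likes_le_1[OF assms(1-3)]
  by (simp add: expectation_bind_finite likes_def[symmetric])

text \<open>Earnings, in units of \<open>1 / M\<close>, plus the value \<open>y\<close> of the stock.\<close>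

definition potential :: "market \<Rightarrow> real \<Rightarrow> (nat \<Rightarrow> real) \<Rightarrow> history \<Rightarrow> real" where
  "potential I M y h = M * revenue I h + (\<Sum>a\<in>unsold I h. y a)"

text \<open>The change of \<open>potential\<close> caused by a sale: the payment minus the value of
  the item that leaves the stock.\<close>

definition surplus :: "market \<Rightarrow> real \<Rightarrow> (nat \<Rightarrow> real) \<Rightarrow> nat \<Rightarrow> nat \<Rightarrow> real" where
  "surplus I M y b a = M * of_rat (price I a b) - y a"

section \<open>The potential while one buyer is served\<close>

lemma unsold_subset: "unsold I h \<subseteq> {..<items I}"
  by (auto simp: unsold_def)

lemma finite_unsold [simp]: "finite (unsold I h)"
  using unsold_subset finite_subset by blast

lemma unsold_append [simp]:
  "unsold I (h @ [Arrives b]) = unsold I h"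
  "unsold I (h @ [Shown a b False]) = unsold I h"
  "unsold I (h @ [Shown a b True]) = unsold I h - {a}"
  by (auto simp: unsold_def)

lemma potential_append [simp]:
  "potential I M y (h @ [Arrives b]) = potential I M y h"
  "potential I M y (h @ [Shown a b False]) = potential I M y h"
  "a \<in> unsold I h \<Longrightarrow> potential I M y (h @ [Shown a b True]) = potential I M y h + surplus I M y b a"
  by (simp_all add: potential_def revenue_def surplus_def algebra_simps sum.remove)

text \<open>The strategy is constrained only on histories in which the current buyer has declined
  all she was shown; no others are consulted while she is served.\<close>

lemma expectation_serve_list:
  assumes "valid_market I" "b < types I"
    and "\<And>ys zs. L = ys @ zs \<Longrightarrow>
      \<sigma> (h @ map (\<lambda>a. Shown a b False) ys) = (case zs of [] \<Rightarrow> None | a # _ \<Rightarrow> Some a)"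
    and "distinct L" "set L \<subseteq> unsold I h" "set L \<subseteq> S" "length L \<le> k"
  shows "measure_pmf.expectation (serve I \<sigma> b k S h) (potential I M y) =
    potential I M y h + list_value (\<lambda>a. likes I a b) (surplus I M y b) L"
  using assms(3-)
proof (induction L arbitrary: h S k)
  case Nil
  from Nil(1)[of "[]" "[]"] have "\<sigma> h = None" by simp
  then show ?case by (cases k) auto
next
  case (Cons a L)
  then obtain k' where k: "k = Suc k'" by (cases k) auto
  from Cons.prems(1)[of "[]"] have \<sigma>: "\<sigma> h = Some a" by simp
  have a: "a < items I" using Cons.prems unsold_subset by fastforce
  have "measure_pmf.expectation (serve I \<sigma> b k' (S - {a}) (h @ [Shown a b False])) (potential I M y) =
    potential I M y (h @ [Shown a b False]) + list_value (\<lambda>a. likes I a b) (surplus I M y b) L"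
  proof (rule Cons.IH)
    fix ys zs assume "L = ys @ zs"
    then show "\<sigma> ((h @ [Shown a b False]) @ map (\<lambda>a. Shown a b False) ys)
        = (case zs of [] \<Rightarrow> None | a # _ \<Rightarrow> Some a)"
      using Cons.prems(1)[of "a # ys" zs] by simp
  qed (use Cons.prems k in auto)
  then show ?case
    using expectation_serve_Some[where \<sigma> = \<sigma> and h = h, OF assms(1) a assms(2) \<sigma>, of S k' "potential I M y"] Cons.prems k
    by (simp add: algebra_simps del: serve.simps)
qed

text \<open>A threshold argument as for prophet inequalities: a buyer takes at most one item, so she
  contributes at most \<open>u\<close> plus the excess over \<open>u\<close> of the item bought, and
  \<open>c\<close> bounds the total expected excess of any \<open>k\<close> items shown.\<close>

lemma expectation_serve_le:
  assumes "valid_market I" "b < types I" "0 \<le> u"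
    and "S \<subseteq> unsold I h"
    and "\<And>A. A \<subseteq> S \<Longrightarrow> card A \<le> k \<Longrightarrow> (\<Sum>a\<in>A. max 0 (likes I a b * (surplus I M y b a - u))) \<le> c"
  shows "measure_pmf.expectation (serve I \<sigma> b k S h) (potential I M y) \<le> potential I M y h + (u + c)"
  using assms(4-)
proof (induction k arbitrary: S h c)
  case 0
  from 0(2)[of "{}"] show ?case using assms(3) by simp
next
  case (Suc k)
  have c: "0 \<le> c" using Suc.prems(2)[of "{}"] by simp
  show ?case
  proof (cases "\<exists>a\<in>S. \<sigma> h = Some a")
    case False
    then have "serve I \<sigma> b (Suc k) S h = return_pmf h" by (auto split: option.splits)
    then show ?thesis using assms(3) c by simp
  next
    case True
    then obtain a where a: "a \<in> S" "\<sigma> h = Some a" by blast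
    then have am: "a < items I" using Suc.prems(1) unsold_subset by blast
    let ?f = "\<lambda>a. max 0 (likes I a b * (surplus I M y b a - u))"
    let ?p = "likes I a b"
    have finS: "finite S" using Suc.prems(1) finite_unsold finite_subset by blast
    have IH: "measure_pmf.expectation (serve I \<sigma> b k (S - {a}) (h @ [Shown a b False])) (potential I M y)
        \<le> potential I M y (h @ [Shown a b False]) + (u + (c - ?f a))"
    proof (rule Suc.IH)
      fix A assume A: "A \<subseteq> S - {a}" "card A \<le> k"
      then have "finite A" "a \<notin> A" "A \<subseteq> S" using finS finite_subset by blast+
      then show "(\<Sum>a\<in>A. ?f a) \<le> c - ?f a"
        using Suc.prems(2)[of "insert a A"] A a by simp
    qed (use Suc.prems in auto)
    have p: "0 \<le> ?p" "?p \<le> 1" using likes_nonneg likes_le_1 assms(1,2) am by auto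
    have ca: "0 \<le> c - ?f a" using Suc.prems(2)[of "{a}"] a by simp
    have "measure_pmf.expectation (serve I \<sigma> b (Suc k) S h) (potential I M y) =
      ?p * (potential I M y h + surplus I M y b a) + (1 - ?p) *
      measure_pmf.expectation (serve I \<sigma> b k (S - {a}) (h @ [Shown a b False])) (potential I M y)"
      using expectation_serve_Some[where \<sigma> = \<sigma> and h = h, OF assms(1) am assms(2) a(2,1)] Suc.prems(1) a
      by (auto simp del: serve.simps)
    also have "\<dots> \<le> ?p * (potential I M y h + surplus I M y b a) +
      (1 - ?p) * (potential I M y h + (u + (c - ?f a)))"
      using IH p by (intro add_left_mono mult_left_mono) auto
    also have "\<dots> = potential I M y h + u + ?p * (surplus I M y b a - u) + (1 - ?p) * (c - ?f a)"
      by (simp add: algebra_simps)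
    \<comment> \<open>Bounding \<open>1 - ?p\<close> by 1 restores exactly the excess
      \<open>?f a\<close> that was split off from \<open>c\<close> for the remaining items.\<close>
    also have "\<dots> \<le> potential I M y h + u + ?f a + 1 * (c - ?f a)"
      using p ca by (intro add_mono mult_right_mono) auto
    finally show ?thesis by simp
  qed
qed

text \<open>Since the stock values \<open>y\<close> do not change over time, the increases of the
  potential caused by the single buyers simply add up.\<close>

lemma expectation_run_le:
  assumes "valid_market I" "0 < buyers I"
    and "\<And>i b. i < n \<Longrightarrow> b < types I \<Longrightarrow> 0 < copies I b \<Longrightarrow> 0 \<le> u i b"
    and "\<And>i b A. i < n \<Longrightarrow> b < types I \<Longrightarrow> 0 < copies I b \<Longrightarrow> A \<subseteq> {..<items I} \<Longrightarrow>
      card A \<le> patience I b \<Longrightarrow> (\<Sum>a\<in>A. max 0 (likes I a b * (surplus I M y b a - u i b))) \<le> c i b"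
  shows "measure_pmf.expectation (run I \<sigma> n) (potential I M y)
    \<le> (\<Sum>a<items I. y a) + (\<Sum>i<n. \<Sum>b<types I. copies I b / buyers I * (u i b + c i b))"
  using assms(3,4)
proof (induction n)
  case 0
  have "unsold I [] = {..<items I}" by (auto simp: unsold_def)
  then show ?case by (simp add: potential_def revenue_def)
next
  case (Suc n)
  define R where "R = (\<Sum>b<types I. copies I b / buyers I * (u n b + c n b))"
  have "measure_pmf.expectation (run I \<sigma> (Suc n)) (potential I M y)
      \<le> measure_pmf.expectation (run I \<sigma> n) (\<lambda>h. potential I M y h + R)"
    unfolding expectation_run_Suc[OF assms(2)]
  proof (rule expectation_mono_finite[OF finite_run[OF assms(2)]])
    fix h
    have "(\<Sum>b<types I. copies I b / buyers I *
        measure_pmf.expectation (serve I \<sigma> b (patience I b) (unsold I h) (h @ [Arrives b])) (potential I M y))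
      \<le> (\<Sum>b<types I. copies I b / buyers I * (potential I M y h + (u n b + c n b)))"
    proof (rule sum_mono)
      fix b assume b: "b \<in> {..<types I}"
      show "copies I b / buyers I *
          measure_pmf.expectation (serve I \<sigma> b (patience I b) (unsold I h) (h @ [Arrives b])) (potential I M y)
        \<le> copies I b / buyers I * (potential I M y h + (u n b + c n b))"
      proof (cases "copies I b = 0")
        case False
        have "measure_pmf.expectation (serve I \<sigma> b (patience I b) (unsold I h) (h @ [Arrives b])) (potential I M y)
            \<le> potential I M y (h @ [Arrives b]) + (u n b + c n b)"
        proof (rule expectation_serve_le[OF assms(1)])
          fix A assume "A \<subseteq> unsold I h" "card A \<le> patience I b"
          then show "(\<Sum>a\<in>A. max 0 (likes I a b * (surplus I M y b a - u n b))) \<le> c n b"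
            using b False unsold_subset by (intro Suc.prems(2)) blast+
        qed (use b False Suc.prems(1) in auto)
        then show ?thesis by (intro mult_left_mono) auto
      qed simp
    qed
    also have "\<dots> = potential I M y h + R"
      using sum_copies[OF assms(2), of "potential I M y h"]
      by (simp add: R_def distrib_left sum.distrib)
    finally show "(\<Sum>b<types I. copies I b / buyers I *
        measure_pmf.expectation (serve I \<sigma> b (patience I b) (unsold I h) (h @ [Arrives b])) (potential I M y))
      \<le> potential I M y h + R" .
  qed
  also have "\<dots> = measure_pmf.expectation (run I \<sigma> n) (potential I M y) + R"
    using finite_run[OF assms(2)] by (simp add: integrable_measure_pmf_finite)
  also have "\<dots> \<le> (\<Sum>a<items I. y a) +
      (\<Sum>i<n. \<Sum>b<types I. copies I b / buyers I * (u i b + c i b)) + R"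
    by (intro add_right_mono Suc.IH) (use Suc.prems in auto)
  finally show ?case by (simp add: R_def)
qed

text \<open>The number of arrivals, the type of the current buyer, the marks of the sold items, and for each
  item the number of the buyer who last declined it (0 if there is none).\<close>

fun observe :: "nat \<times> nat \<times> (nat \<Rightarrow> nat) \<times> (nat \<Rightarrow> nat) \<Rightarrow> event \<Rightarrow> nat \<times> nat \<times> (nat \<Rightarrow> nat) \<times> (nat \<Rightarrow> nat)" where
  "observe (i, c, sold, declined) (Arrives b) = (Suc i, b, sold, declined)"
| "observe (i, c, sold, declined) (Shown a b l) =
     (if l then (i, c, sold(a := 1), declined) else (i, c, sold, declined(a := i)))"

definition observed :: "history \<Rightarrow> nat \<times> nat \<times> (nat \<Rightarrow> nat) \<times> (nat \<Rightarrow> nat)" where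
  "observed h = foldl observe (0, 0, \<lambda>_. 0, \<lambda>_. 0) h"

text \<open>A product of truncated differences, which the program can evaluate directly. Comparing
  the number of the last decliner with that of the current buyer avoids clearing marks at each
  arrival.\<close>

definition allowed :: "history \<Rightarrow> nat \<Rightarrow> bool" where
  "allowed h a = (case observed h of (i, c, sold, declined) \<Rightarrow> (1 - sold a) * (i - declined a) \<noteq> 0)"

text \<open>\<open>poly_time\<close> admits arbitrary histories, so an arrival of a type out of
  range must be answered too. As \<open>i\<close> counts the current buyer,
  \<open>buyers I - i\<close> buyers come after her.\<close>

definition plan :: "market \<Rightarrow> strategy" where
  "plan I h = (case observed h of (i, c, _) \<Rightarrow>
     if c < types I then find (allowed h) (showlist I (buyers I - i) c) else None)"

section \<open>Reading the state off the history\<close>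

lemma observed_append [simp]: "observed (h @ [e]) = observe (observed h) e"
  by (simp add: observed_def)

lemma observed_Nil [simp]: "observed [] = (0, 0, \<lambda>_. 0, \<lambda>_. 0)"
  by (simp add: observed_def)

lemma observed_props:
  "observed h = (i, c, sold, declined) \<Longrightarrow>
    declined a \<le> i \<and> sold a = of_bool (\<exists>b. Shown a b True \<in> set h)"
proof (induction h arbitrary: i c sold declined rule: rev_induct)
  case (snoc e h)
  obtain i' c' s' d' where o: "observed h = (i', c', s', d')" by (metis prod_cases4)
  note IH = snoc.IH[OF o]
  show ?case
  proof (cases e)
    case (Arrives b)
    then show ?thesis using snoc.prems IH o by auto
  next
    case (Shown a' b l)
    then show ?thesis using snoc.prems IH o by (cases l) (auto split: if_splits)
  qed
qed simp

lemma observed_declines: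
  assumes "observed h = (i, c, sold, declined)"
  shows "\<exists>d. observed (h @ map (\<lambda>a. Shown a b False) xs) = (i, c, sold, d) \<and>
    (\<forall>a. d a = (if a \<in> set xs then i else declined a))"
proof (induction xs rule: rev_induct)
  case (snoc x xs)
  then obtain d where d: "observed (h @ map (\<lambda>a. Shown a b False) xs) = (i, c, sold, d)"
    "\<forall>a. d a = (if a \<in> set xs then i else declined a)" by blast
  then have "observed (h @ map (\<lambda>a. Shown a b False) (xs @ [x])) = (i, c, sold, d(x := i))"
    by (simp flip: append_assoc)
  with d(2) show ?case by auto
qed (use assms in auto)

lemma find_filter: "find Q (filter P L) = find (\<lambda>a. P a \<and> Q a) L"
  by (induction L) auto

lemma find_skip: "(\<And>x. x \<in> set xs \<Longrightarrow> \<not> P x) \<Longrightarrow> find P (xs @ ys) = find P ys"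
  by (induction xs) auto

text \<open>Provides the hypothesis on the strategy in \<open>expectation_serve_list\<close>: on the
  list, \<open>allowed\<close> excludes exactly the sold items and the declined prefix
  \<open>ys\<close>, so the search stops at the head of \<open>zs\<close>.\<close>

lemma plan_declines:
  assumes "fst (observed h) = i" "b < types I" "set (showlist I (buyers I - Suc i) b) \<subseteq> {..<items I}"
    and "distinct (showlist I (buyers I - Suc i) b)"
    and "filter (\<lambda>a. a \<in> unsold I h) (showlist I (buyers I - Suc i) b) = ys @ zs"
  shows "plan I ((h @ [Arrives b]) @ map (\<lambda>a. Shown a b False) ys) = (case zs of [] \<Rightarrow> None | a # _ \<Rightarrow> Some a)"
proof -
  let ?h = "(h @ [Arrives b]) @ map (\<lambda>a. Shown a b False) ys" and ?L = "showlist I (buyers I - Suc i) b"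
  obtain c sold d where o: "observed h = (i, c, sold, d)" using assms(1) by (metis prod_cases4 fst_conv)
  then have "observed (h @ [Arrives b]) = (Suc i, b, sold, d)" by simp
  from observed_declines[OF this] obtain d' where
    o': "observed ?h = (Suc i, b, sold, d')" "\<forall>a. d' a = (if a \<in> set ys then Suc i else d a)"
    by blast
  have allowed: "allowed ?h a \<longleftrightarrow> a \<in> unsold I h \<and> a \<notin> set ys" if "a \<in> set ?L" for a
  proof -
    have "allowed ?h a \<longleftrightarrow> sold a = 0 \<and> a \<notin> set ys"
      using o' observed_props[OF o, of a] by (auto simp: allowed_def)
    then show ?thesis using observed_props[OF o, of a] that assms(3) by (auto simp: unsold_def)
  qed
  have "plan I ?h = find (allowed ?h) ?L" using o' assms(2) by (simp add: plan_def)
  also have "\<dots> = find (\<lambda>a. a \<in> unsold I h \<and> a \<notin> set ys) ?L"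
    by (intro find_cong allowed refl)
  also have "\<dots> = find (\<lambda>a. a \<notin> set ys) (ys @ zs)"
    by (simp add: find_filter flip: assms(5))
  also have "\<dots> = find (\<lambda>a. a \<notin> set ys) zs" by (rule find_skip) simp
  also have "\<dots> = (case zs of [] \<Rightarrow> None | a # _ \<Rightarrow> Some a)"
  proof -
    have "distinct (ys @ zs)" using assms(4) by (simp flip: assms(5))
    then show ?thesis by (cases zs) auto
  qed
  finally show ?thesis .
qed

lemma observed_serve: "h' \<in> set_pmf (serve I \<sigma> b k S h) \<Longrightarrow> fst (observed h') = fst (observed h)"
proof (induction k arbitrary: S h)
  case (Suc k)
  have shown: "fst (observed (h @ [Shown a b l])) = fst (observed h)" for a l
    by (cases "observed h") auto
  show ?case
  proof (cases "\<exists>a\<in>S. \<sigma> h = Some a")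
    case False
    with Suc.prems show ?thesis by (auto split: option.splits if_splits)
  next
    case True
    then obtain a where "a \<in> S" "\<sigma> h = Some a" by blast
    with Suc.prems Suc.IH[of "S - {a}" "h @ [Shown a b False]"] shown
    show ?thesis by (auto simp del: observed_append split: if_splits)
  qed
qed simp

lemma observed_run: "h \<in> set_pmf (run I \<sigma> i) \<Longrightarrow> fst (observed h) = i"
proof (induction i arbitrary: h)
  case (Suc i)
  then obtain h0 b where h: "h0 \<in> set_pmf (run I \<sigma> i)"
      "h \<in> set_pmf (serve I \<sigma> b (patience I b) (unsold I h0) (h0 @ [Arrives b]))"
    by auto
  from observed_serve[OF h(2)] Suc.IH[OF h(1)] show ?case by (cases "observed h0") auto
qed simp

section \<open>Revenue of the greedy plan\<close>

lemma list_value_mono: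
  assumes "\<And>a. a \<in> set L \<Longrightarrow> 0 \<le> p a \<and> p a \<le> 1 \<and> r a \<le> r' a"
  shows "list_value p r L \<le> list_value p r' L"
  using assms by (induction L) (auto intro!: add_mono mult_left_mono)

lemma prices_within_mono: "b \<le> b' \<Longrightarrow> prices_within I v b a \<le> prices_within I v b' a"
proof (induction b' rule: dec_induct)
  case (step n)
  obtain v' U L where "greedy I n (prices_within I v n) (picks I n) = (v', U, L)" by (metis prod_cases3)
  from greedy_basic(5)[OF this, of a] step.IH this show ?case by simp
qed simp

lemma sum_prices_within:
  "(\<Sum>b<k. real (prices_within I v (Suc b) a) - real (prices_within I v b a)) =
    real (prices_within I v k a) - real (v a)"
  using sum_lessThan_telescope[of "\<lambda>b. real (prices_within I v b a)" k] by simp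

lemma prices_mono: "j \<le> j' \<Longrightarrow> prices I j a \<le> prices I j' a"
proof (induction j' rule: dec_induct)
  case (step n)
  then show ?case using prices_within_mono[of 0 "types I" I "prices I n" a] by simp
qed simp

lemma scaled_price_le: "0 \<le> price I a b \<Longrightarrow> scaled_price I a b \<le> real (market_scale I ^ 10) * of_rat (price I a b)"
  and scaled_price_gt: "0 \<le> price I a b \<Longrightarrow> real (market_scale I ^ 10) * of_rat (price I a b) \<le> scaled_price I a b + 1"
proof -
  assume p: "0 \<le> price I a b"
  have d: "0 < denom (price I a b)" by (rule denom_pos)
  have e: "real (market_scale I ^ 10) * of_rat (price I a b) =
      real (market_scale I ^ 10 * numer (price I a b)) / real (denom (price I a b))"
    using p by (simp add: of_rat_numer_denom)
  show "scaled_price I a b \<le> real (market_scale I ^ 10) * of_rat (price I a b)"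
    unfolding e scaled_price_def by (rule of_nat_div_le_of_nat)
  have "real (market_scale I ^ 10 * numer (price I a b)) \<le>
      real (denom (price I a b)) * real (scaled_price I a b + 1)"
    unfolding scaled_price_def by (rule div_upper[OF d])
  then show "real (market_scale I ^ 10) * of_rat (price I a b) \<le> scaled_price I a b + 1"
    unfolding e using d by (simp add: field_simps del: of_nat_mult of_nat_power)
qed

lemma showlist_props:
  "set (showlist I j b) \<subseteq> {..<items I}" "distinct (showlist I j b)" "length (showlist I j b) \<le> picks I b"
proof -
  obtain v U L where g: "greedy I b (prices_within I (prices I j) b) (picks I b) = (v, U, L)"
    by (metis prod_cases3)
  show "set (showlist I j b) \<subseteq> {..<items I}" "distinct (showlist I j b)" "length (showlist I j b) \<le> picks I b"
    using greedy_basic(1-3)[OF g] g by (auto simp: showlist_def)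
qed

text \<open>The submartingale property. Revaluing the stock at the prices for one buyer fewer loses
  the price increases of one backward step; the expected surplus from the shown list makes up for
  them, type by type.\<close>

lemma plan_step:
  assumes "valid_market I" "0 < buyers I" "fst (observed h) = i" "i < buyers I"
  defines "M \<equiv> real (market_scale I ^ 10)" and "j \<equiv> buyers I - Suc i"
  shows "potential I M (prices I (buyers I - i)) h \<le> (\<Sum>b<types I. copies I b / buyers I *
      measure_pmf.expectation (serve I (plan I) b (patience I b) (unsold I h) (h @ [Arrives b]))
        (potential I M (prices I j)))"
proof -
  let ?X = "unsold I h" and ?y = "\<lambda>a. real (prices I j a)"
  let ?v = "prices_within I (prices I j)"
  let ?\<Delta> = "\<lambda>b. \<Sum>a\<in>?X. real (?v (Suc b) a) - real (?v b a)"
  have "potential I M ?y h + ?\<Delta> b * buyers I / copies I b \<le>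
      measure_pmf.expectation (serve I (plan I) b (patience I b) ?X (h @ [Arrives b])) (potential I M ?y)"
    if b: "b < types I" and c: "0 < copies I b" for b
  proof -
    define L where "L = filter (\<lambda>a. a \<in> ?X) (showlist I j b)"
    obtain v' U L' where g: "greedy I b (?v b) (picks I b) = (v', U, L')" by (metis prod_cases3)
    have "measure_pmf.expectation (serve I (plan I) b (patience I b) ?X (h @ [Arrives b])) (potential I M ?y)
      = potential I M ?y (h @ [Arrives b]) + list_value (\<lambda>a. likes I a b) (surplus I M ?y b) L"
    proof (rule expectation_serve_list[OF assms(1) b])
      show "plan I ((h @ [Arrives b]) @ map (\<lambda>a. Shown a b False) ys)
          = (case zs of [] \<Rightarrow> None | a # _ \<Rightarrow> Some a)" if "L = ys @ zs" for ys zs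
        by (rule plan_declines[OF assms(3) b])
          (use that showlist_props in \<open>auto simp: L_def j_def\<close>)
      show "length L \<le> patience I b"
        using showlist_props(3)[of I j b] length_filter_le[of "\<lambda>a. a \<in> ?X" "showlist I j b"]
        by (simp add: L_def picks_def del: length_filter_le)
    qed (auto simp: L_def showlist_props)
    moreover have "?\<Delta> b * buyers I / copies I b \<le> list_value (\<lambda>a. likes I a b) (surplus I M ?y b) L"
    proof -
      \<comment> \<open>The list was selected at the prices \<open>?v b\<close>, already raised for
        smaller types, whereas the stock is valued at the lower \<open>prices I j\<close> once this
        buyer is gone.\<close>
      have "?\<Delta> b * buyers I \<le> copies I b * list_value (\<lambda>a. likes I a b) (\<lambda>a. real (scaled_price I a b) - ?y a) L"
        using greedy_list_value[OF assms(1) b assms(2) g, of ?y ?X] prices_within_mono[of 0 b I "prices I j"] g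
        by (simp add: L_def showlist_def)
      also have "\<dots> \<le> copies I b * list_value (\<lambda>a. likes I a b) (surplus I M ?y b) L"
      proof (intro mult_left_mono list_value_mono)
        fix a assume "a \<in> set L"
        then have "a < items I" using showlist_props(1) by (auto simp: L_def)
        with b assms(1) show "0 \<le> likes I a b \<and> likes I a b \<le> 1 \<and>
            real (scaled_price I a b) - ?y a \<le> surplus I M ?y b a"
          using scaled_price_le[of I a b]
          by (auto simp: likes_nonneg likes_le_1 surplus_def M_def valid_market_def)
      qed simp
      finally show ?thesis using c by (simp add: field_simps)
    qed
    ultimately show ?thesis by simp
  qed note step = this
  have "potential I M (prices I (buyers I - i)) h = potential I M ?y h + (\<Sum>b<types I. ?\<Delta> b)"
  proof -
    have Suc: "buyers I - i = Suc j" using assms(4) by (simp add: j_def)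
    have "(\<Sum>b<types I. ?\<Delta> b) = (\<Sum>a\<in>?X. \<Sum>b<types I. real (?v (Suc b) a) - real (?v b a))"
      by (rule sum.swap)
    also have "\<dots> = (\<Sum>a\<in>?X. real (prices I (Suc j) a) - ?y a)"
      by (simp add: sum_prices_within del: prices_within.simps(2))
    finally show ?thesis by (simp add: potential_def Suc sum_subtractf)
  qed
  also have "\<dots> = (\<Sum>b<types I. copies I b / buyers I * potential I M ?y h) + (\<Sum>b<types I. ?\<Delta> b)"
    using sum_copies[OF assms(2)] by simp
  also have "\<dots> = (\<Sum>b<types I. copies I b / buyers I * potential I M ?y h + ?\<Delta> b)"
    by (simp add: sum.distrib)
  also have "\<dots> \<le> (\<Sum>b<types I. copies I b / buyers I *
      measure_pmf.expectation (serve I (plan I) b (patience I b) ?X (h @ [Arrives b])) (potential I M ?y))"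
  proof (rule sum_mono)
    fix b assume b: "b \<in> {..<types I}"
    let ?E = "measure_pmf.expectation (serve I (plan I) b (patience I b) ?X (h @ [Arrives b])) (potential I M ?y)"
    show "copies I b / buyers I * potential I M ?y h + ?\<Delta> b \<le> copies I b / buyers I * ?E"
    proof (cases "copies I b = 0")
      \<comment> \<open>Dividing by the number of copies is meaningless here; instead, a type that
        never arrives raises no price, so its increase is at most 0.\<close>
      case True
      obtain v' U L' where g: "greedy I b (?v b) (picks I b) = (v', U, L')" by (metis prod_cases3)
      have "?\<Delta> b * buyers I \<le> copies I b * list_value (\<lambda>a. likes I a b)
          (\<lambda>a. real (scaled_price I a b) - real (?v b a)) (filter (\<lambda>a. a \<in> ?X) L')"
        using greedy_list_value[OF assms(1) _ assms(2) g, of "?v b" ?X] g b by simp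
      then show ?thesis using True assms(2) by (simp add: mult_le_0_iff)
    next
      case False
      then have "copies I b / buyers I * (potential I M ?y h + ?\<Delta> b * buyers I / copies I b)
          \<le> copies I b / buyers I * ?E"
        using b by (intro mult_left_mono step) auto
      then show ?thesis using False assms(2) by (simp add: distrib_left)
    qed
  qed
  finally show ?thesis .
qed

text \<open>The potential starts as the full stock at final prices and ends as earnings alone, since
  all prices are 0 after the last buyer.\<close>

lemma plan_revenue:
  assumes "valid_market I" "0 < buyers I"
  defines "M \<equiv> real (market_scale I ^ 10)"
  shows "(\<Sum>a<items I. real (prices I (buyers I) a)) \<le>
    M * measure_pmf.expectation (run I (plan I) (buyers I)) (revenue I)"
proof -
  have "(\<Sum>a<items I. real (prices I (buyers I) a)) \<le>
      measure_pmf.expectation (run I (plan I) i) (potential I M (prices I (buyers I - i)))"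
    if "i \<le> buyers I" for i
    using that
  proof (induction i)
    case 0
    have "unsold I [] = {..<items I}" by (auto simp: unsold_def)
    then show ?case by (simp add: potential_def revenue_def)
  next
    case (Suc i)
    then have "(\<Sum>a<items I. real (prices I (buyers I) a)) \<le>
      measure_pmf.expectation (run I (plan I) i) (potential I M (prices I (buyers I - i)))" by simp
    also have "\<dots> \<le> measure_pmf.expectation (run I (plan I) (Suc i)) (potential I M (prices I (buyers I - Suc i)))"
      unfolding expectation_run_Suc[OF assms(2)] M_def
      by (intro expectation_mono_finite finite_run assms plan_step) (use Suc.prems observed_run in auto)
    finally show ?case .
  qed
  from this[of "buyers I"] show ?thesis
    by (simp add: potential_def[abs_def])
qed

lemma revenue_nonneg:
  "valid_market I \<Longrightarrow> h \<in> set_pmf (run I \<sigma> (buyers I)) \<Longrightarrow> 0 \<le> revenue I h"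
  by (cases "buyers I = 0") (auto simp: revenue_def dest: run_revenue)

section \<open>Upper bound for every strategy\<close>

text \<open>One share of the price sum is the initial stock; two come from threshold and excess,
  about \<open>U\<close> each, whose averages telescope over the backward steps. The error per buyer
  consists of 1 for rounding \<open>scaled_price\<close>, \<open>items I\<close> from
  \<open>greedy_surplus\<close>, and \<open>2 * items I * types I\<close> from using
  \<open>greedy_upper\<close> twice for each type.\<close>

lemma strategy_revenue_le:
  assumes "valid_market I" "0 < buyers I"
  defines "M \<equiv> real (market_scale I ^ 10)"
  shows "M * measure_pmf.expectation (run I \<sigma> (buyers I)) (revenue I)
    \<le> 3 * (\<Sum>a<items I. real (prices I (buyers I) a)) +
       real (buyers I * (2 * items I * types I + items I + 1))"
proof -
  let ?n = "buyers I"
  let ?y = "\<lambda>a. real (prices I ?n a)"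
  let ?m = "items I" and ?T = "types I"
  define v where "v = (\<lambda>j. prices_within I (prices I j))"
  define U where "U = (\<lambda>j b. real (fst (snd (greedy I b (v j b) (picks I b)))))"
  have g: "greedy I b (v j b) (picks I b) = (v j (Suc b), fst (snd (greedy I b (v j b) (picks I b))), showlist I j b)"
    for j b by (simp add: v_def showlist_def)
  have v_le: "v j b a \<le> prices I ?n a" if "j < ?n" "b \<le> ?T" for j b a
  proof -
    have "v j b a \<le> prices I (Suc j) a" using prices_within_mono[OF that(2)] by (simp add: v_def)
    also have "\<dots> \<le> prices I ?n a" using that by (intro prices_mono) simp
    finally show ?thesis .
  qed
  have "measure_pmf.expectation (run I \<sigma> ?n) (potential I M ?y) \<le>
      (\<Sum>a<?m. ?y a) + (\<Sum>j<?n. \<Sum>b<?T. copies I b / ?n * ((U j b + 1) + (U j b + ?m)))"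
  proof (rule expectation_run_le[OF assms(1,2)])
    \<comment> \<open>Buyer number \<open>j\<close> is charged to backward step \<open>j\<close>,
      although \<open>buyers I - Suc j\<close> buyers follow her. Any bijection of buyers and steps
      would do, because the fixed stock values are at least all intermediate prices.\<close>
    fix j b A assume *: "j < ?n" "b < ?T" "A \<subseteq> {..<?m}" "card A \<le> patience I b"
    have "card A \<le> ?m" using card_mono[OF _ *(3)] by simp
    with *(4) have card: "card A \<le> picks I b" by (simp add: picks_def)
    have "(\<Sum>a\<in>A. max 0 (likes I a b * (surplus I M ?y b a - (U j b + 1))))
        \<le> (\<Sum>a\<in>A. max 0 (likes I a b * (real (scaled_price I a b) - v j b a - U j b)))"
    proof (rule sum_mono)
      fix a assume "a \<in> A"
      then have a: "a < ?m" using * by auto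
      have "surplus I M ?y b a - (U j b + 1) \<le> real (scaled_price I a b) - v j b a - U j b"
        using scaled_price_gt[of I a b] v_le[of j b a] * a assms(1)
        by (auto simp: surplus_def M_def valid_market_def)
      then show "max 0 (likes I a b * (surplus I M ?y b a - (U j b + 1)))
          \<le> max 0 (likes I a b * (real (scaled_price I a b) - v j b a - U j b))"
        using likes_nonneg[OF assms(1) a *(2)] by (intro max.mono mult_left_mono) auto
    qed
    also have "\<dots> \<le> U j b + picks I b"
      using greedy_surplus[OF assms(1) *(2) g _ *(3) card] unfolding U_def by auto
    also have "\<dots> \<le> U j b + ?m" by (simp add: picks_def)
    finally show "(\<Sum>a\<in>A. max 0 (likes I a b * (surplus I M ?y b a - (U j b + 1)))) \<le> U j b + ?m" .
  qed (simp add: U_def)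
  also have "(\<Sum>j<?n. \<Sum>b<?T. copies I b / ?n * ((U j b + 1) + (U j b + ?m))) =
      (\<Sum>j<?n. 2 * (\<Sum>b<?T. copies I b / ?n * U j b) + (?m + 1))"
  proof (rule sum.cong[OF refl])
    fix j
    have "(\<Sum>b<?T. copies I b / ?n * ((U j b + 1) + (U j b + ?m))) =
        (\<Sum>b<?T. 2 * (copies I b / ?n * U j b) + copies I b / ?n * (?m + 1))"
      by (intro sum.cong) (auto simp: algebra_simps add_divide_distrib)
    then show "(\<Sum>b<?T. copies I b / ?n * ((U j b + 1) + (U j b + ?m))) =
        2 * (\<Sum>b<?T. copies I b / ?n * U j b) + (?m + 1)"
      using sum_copies[OF assms(2), of "real (?m + 1)"] by (simp add: sum.distrib sum_distrib_left)
  qed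
  also have "\<dots> \<le> (\<Sum>j<?n. 2 * ((\<Sum>a<?m. real (prices I (Suc j) a) - real (prices I j a)) + ?m * ?T) + (?m + 1))"
  proof (intro sum_mono add_right_mono mult_left_mono)
    fix j
    have "(\<Sum>b<?T. copies I b / ?n * U j b) \<le>
        (\<Sum>b<?T. (\<Sum>a<?m. real (v j (Suc b) a) - real (v j b a)) + ?m)"
    proof (rule sum_mono)
      fix b assume "b \<in> {..<?T}"
      then have "copies I b * U j b \<le> ?n * ((\<Sum>a<?m. real (v j (Suc b) a) - real (v j b a)) + picks I b)"
        using greedy_upper[OF assms(1) _ assms(2) g[of b j]] by (simp add: U_def)
      also have "\<dots> \<le> ?n * ((\<Sum>a<?m. real (v j (Suc b) a) - real (v j b a)) + ?m)"
        by (intro mult_left_mono) (auto simp: picks_def)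
      finally show "copies I b / ?n * U j b \<le> (\<Sum>a<?m. real (v j (Suc b) a) - real (v j b a)) + ?m"
        using assms(2) by (simp add: field_simps)
    qed
    also have "\<dots> = (\<Sum>a<?m. \<Sum>b<?T. real (v j (Suc b) a) - real (v j b a)) + ?m * ?T"
      by (subst sum.swap) (simp add: sum.distrib mult.commute)
    also have "\<dots> = (\<Sum>a<?m. real (prices I (Suc j) a) - real (prices I j a)) + ?m * ?T"
      by (simp add: sum_prices_within v_def del: prices_within.simps(2))
    finally show "(\<Sum>b<?T. copies I b / ?n * U j b) \<le>
        (\<Sum>a<?m. real (prices I (Suc j) a) - real (prices I j a)) + ?m * ?T" by simp
  qed simp
  also have "\<dots> = 2 * (\<Sum>a<?m. \<Sum>j<?n. real (prices I (Suc j) a) - real (prices I j a)) +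
      real (?n * (2 * ?m * ?T + ?m + 1))"
    by (subst sum.swap) (simp add: sum.distrib sum_distrib_left algebra_simps)
  also have "(\<Sum>a<?m. \<Sum>j<?n. real (prices I (Suc j) a) - real (prices I j a)) = (\<Sum>a<?m. ?y a)"
    by (intro sum.cong refl) (use sum_lessThan_telescope[of "\<lambda>j. real (prices I j _)" ?n] in \<open>simp del: prices.simps(2)\<close>)
  finally have le: "measure_pmf.expectation (run I \<sigma> ?n) (potential I M ?y) \<le>
      3 * (\<Sum>a<?m. ?y a) + real (?n * (2 * ?m * ?T + ?m + 1))" by simp
  have "M * measure_pmf.expectation (run I \<sigma> ?n) (revenue I) =
      measure_pmf.expectation (run I \<sigma> ?n) (\<lambda>h. M * revenue I h)" by simp
  also have "\<dots> \<le> measure_pmf.expectation (run I \<sigma> ?n) (potential I M ?y)"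
    by (intro expectation_mono_finite finite_run assms) (simp add: potential_def sum_nonneg)
  finally show ?thesis using le by simp
qed

section \<open>Worthless markets and the size of the rounding error\<close>

text \<open>Covers the markets excluded by \<open>prices_large\<close>. Stock values and thresholds
  0 make every excess vanish, and no rounding is involved.\<close>

lemma worthless_revenue:
  assumes "valid_market I" "0 < buyers I"
    and "\<And>a b. a < items I \<Longrightarrow> b < types I \<Longrightarrow> 0 < copies I b \<Longrightarrow> like_prob I a b * price I a b = 0"
  shows "measure_pmf.expectation (run I \<sigma> (buyers I)) (revenue I) \<le> 0"
proof -
  have "measure_pmf.expectation (run I \<sigma> (buyers I)) (potential I 1 (\<lambda>_. 0)) \<le>
      (\<Sum>a<items I. 0) + (\<Sum>j<buyers I. \<Sum>b<types I. copies I b / buyers I * (0 + 0))"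
  proof (rule expectation_run_le[OF assms(1,2)])
    fix b A assume b: "b < types I" "0 < copies I b" and A: "A \<subseteq> {..<items I}"
    have "max 0 (likes I a b * (surplus I 1 (\<lambda>_. 0) b a - 0)) = 0" if "a \<in> A" for a
    proof -
      have "max 0 (likes I a b * (surplus I 1 (\<lambda>_. 0) b a - 0)) = max 0 (of_rat (like_prob I a b * price I a b))"
        by (simp add: likes_def surplus_def of_rat_mult)
      moreover have "like_prob I a b * price I a b = 0" using assms(3)[OF _ b, of a] that A by auto
      ultimately show ?thesis by (simp only: of_rat_0 max.idem)
    qed
    then show "(\<Sum>a\<in>A. max 0 (likes I a b * (surplus I 1 (\<lambda>_. 0) b a - 0))) \<le> 0" by simp
  qed simp
  then show ?thesis by (simp add: potential_def[abs_def])
qed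

lemma elem_dvd_prod_list: "x \<in> set xs \<Longrightarrow> (1 + x) dvd (\<Prod>x\<leftarrow>xs. 1 + (x::nat))"
  by (induction xs) (auto simp del: mult_Suc)

lemma prod_list_pos: "0 < (\<Prod>x\<leftarrow>xs. 1 + (x::nat))"
  by (induction xs) auto

lemma scale_ge_elem:
  assumes "x \<in> set (encode_market I)"
  shows "x < market_scale I"
proof -
  have "1 + x \<le> (\<Prod>x\<leftarrow>encode_market I. 1 + x)"
    by (rule dvd_imp_le[OF elem_dvd_prod_list[OF assms] prod_list_pos])
  also have "\<dots> \<le> market_scale I" by (simp add: market_scale_def)
  finally show ?thesis by simp
qed

lemma buyers_less_scale: "buyers I < market_scale I"
  using prod_list_pos[of "encode_market I"] mult_le_mono2[of 1 "\<Prod>x\<leftarrow>encode_market I. 1 + x" "1 + buyers I"]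
  by (simp add: market_scale_def)

lemma encode_rat: "encode_rat q = [numer q, denom q]"
  by (simp add: encode_rat_def numer_def denom_def split: prod.split)

lemma scale_greater:
  shows "items I < market_scale I" "types I < market_scale I"
    and "a < items I \<Longrightarrow> b < types I \<Longrightarrow> denom (like_prob I a b) < market_scale I"
    and "a < items I \<Longrightarrow> b < types I \<Longrightarrow> denom (price I a b) < market_scale I"
    and "a < items I \<Longrightarrow> b < types I \<Longrightarrow> numer (price I a b) < market_scale I"
  by (rule scale_ge_elem; force simp: encode_market_def encode_rat)+

text \<open>All input numbers are below the scale \<open>?Z\<close>, so dividing by one of them
  costs at most a factor \<open>?Z\<close>: the scaled price is at least \<open>?Z ^ 9\<close>, a
  gain at least \<open>?Z ^ 7\<close>, a price increase at least \<open>?Z ^ 6\<close>, whereas the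
  rounding error is only cubic in \<open>?Z\<close>. The backward step of the last buyer already
  suffices.\<close>

lemma prices_large:
  assumes "valid_market I" "a < items I" "b < types I" "0 < copies I b"
    and "like_prob I a b * price I a b \<noteq> 0"
  shows "buyers I * (2 * items I * types I + items I + 1) \<le> (\<Sum>a<items I. prices I (buyers I) a)"
proof -
  let ?Z = "market_scale I" and ?n = "buyers I" and ?v = "prices_within I (\<lambda>_. 0)"
  let ?W = "scaled_price I a b"
  have n: "0 < ?n" using assms(3,4) buyer_copies_le[of b I] by simp
  have dp: "0 < denom (like_prob I a b)" and dw: "0 < denom (price I a b)" by (simp_all add: denom_pos)
  have Z2: "2 \<le> ?Z" using buyers_less_scale[of I] n by simp
  have pos: "0 < like_prob I a b" "0 < price I a b"
  proof -
    have "0 \<le> like_prob I a b" "0 \<le> price I a b"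
      using assms(1-3) by (auto simp: valid_market_def)
    moreover have "like_prob I a b \<noteq> 0" "price I a b \<noteq> 0" using assms(5) by auto
    ultimately show "0 < like_prob I a b" "0 < price I a b" by simp_all
  qed
  have np: "1 \<le> numer (like_prob I a b)"
    using of_rat_numer_denom[of "like_prob I a b"] pos by (cases "numer (like_prob I a b)") auto
  have nw: "1 \<le> numer (price I a b)"
    using of_rat_numer_denom[of "price I a b"] pos by (cases "numer (price I a b)") auto
  have W: "?Z ^ 9 \<le> ?W"
  proof -
    have "?Z ^ 9 * denom (price I a b) \<le> ?Z ^ 9 * ?Z"
      using scale_greater(4)[OF assms(2,3)] by (intro mult_le_mono2) simp
    also have "\<dots> = ?Z ^ 10 * 1" by (simp flip: power_Suc2)
    also have "\<dots> \<le> ?Z ^ 10 * numer (price I a b)" using nw by (intro mult_le_mono2)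
    finally show ?thesis using dw unfolding scaled_price_def by (simp add: less_eq_div_iff_mult_less_eq)
  qed
  have Z8: "?Z ^ 8 * 2 \<le> ?Z ^ 9"
    using mult_le_mono2[OF Z2, of "?Z ^ 8"] by (simp flip: power_Suc2)
  define k where "k = picks I b"
  obtain k' where k': "k = Suc k'"
    using assms(1-3) by (cases k) (auto simp: k_def picks_def valid_market_def)
  have final: "?v (Suc b) a' \<le> prices I ?n a'" for a'
  proof -
    have "?v (Suc b) a' \<le> prices I 1 a'"
      using prices_within_mono[of "Suc b" "types I" I "\<lambda>_. 0" a'] assms(3) by simp
    also have "\<dots> \<le> prices I ?n a'" using n by (intro prices_mono) simp
    finally show ?thesis .
  qed
  \<comment> \<open>Smaller types may have raised the price of \<open>a\<close> before. If it has
    reached \<open>?Z ^ 8\<close>, this price is large enough; otherwise a surplus of at least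
    \<open>?Z ^ 9 - ?Z ^ 8\<close>, hence of \<open>?Z ^ 8\<close>, remains because
    \<open>?Z\<close> is at least 2. The first pick may be another item, but then its gain is no
    smaller.\<close>
  have "\<exists>a'<items I. ?Z ^ 6 \<le> ?v (Suc b) a'"
  proof (cases "?Z ^ 8 \<le> ?v b a")
    case True
    have "?Z ^ 6 \<le> ?Z ^ 8" using Z2 by (intro power_increasing) auto
    also note True
    also have "?v b a \<le> ?v (Suc b) a" by (rule prices_within_mono) simp
    finally show ?thesis using assms(2) by blast
  next
    case False
    have g0: "greedy I b (?v b) 0 = (?v b, 0, [])" by (rule greedy_0)
    have gain: "?Z ^ 7 \<le> gain I b (?v b) 0 a"
    proof -
      have "?Z ^ 7 * denom (like_prob I a b) \<le> ?Z ^ 7 * ?Z"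
        using scale_greater(3)[OF assms(2,3)] by (intro mult_le_mono2) simp
      also have "\<dots> = 1 * ?Z ^ 8" by (simp flip: power_Suc2)
      also have "\<dots> \<le> numer (like_prob I a b) * (?W - ?v b a - 0)"
        using np False W Z8 by (intro mult_le_mono) linarith+
      finally show ?thesis using dp unfolding gain_def by (simp add: less_eq_div_iff_mult_less_eq)
    qed
    have "\<exists>a'<items I. \<exists>v' U L. greedy I b (?v b) 1 = (v', U, L) \<and> ?Z ^ 6 \<le> v' a'"
    proof (cases rule: pick_cases[of I b "?v b" 0 "[]"])
      case none
      then have "gain I b (?v b) 0 a = 0" using assms(2) by simp
      with gain Z2 show ?thesis by simp
    next
      case (some a')
      have "?Z ^ 6 * ?n \<le> ?Z ^ 6 * ?Z" using buyers_less_scale[of I] by (intro mult_le_mono2) simp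
      also have "\<dots> = ?Z ^ 7" by (simp flip: power_Suc2)
      also have "\<dots> \<le> gain I b (?v b) 0 a'" using gain some(5)[of a] assms(2) by simp
      also have "\<dots> \<le> copies I b * gain I b (?v b) 0 a'" using assms(4) by simp
      finally have "?Z ^ 6 \<le> copies I b * gain I b (?v b) 0 a' div ?n"
        using n by (simp add: less_eq_div_iff_mult_less_eq)
      then show ?thesis using some(1,2) by (auto simp: greedy_Suc[of _ _ _ 0, simplified] greedy_0)
    qed
    then obtain a' v' U L where a': "a' < items I" "greedy I b (?v b) 1 = (v', U, L)" "?Z ^ 6 \<le> v' a'"
      by blast
    have "v' a' \<le> fst (greedy I b (?v b) (Suc i)) a'" for i
    proof (induction i)
      case (Suc i)
      obtain v'' U'' L'' where g: "greedy I b (?v b) (Suc i) = (v'', U'', L'')" by (metis prod_cases3)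
      show ?case
        by (rule pick_cases[of I b v'' U'' L'']) (use Suc g in \<open>auto simp: greedy_Suc[of _ _ _ "Suc i"]\<close>)
    qed (use a' in simp)
    from this[of k'] have "v' a' \<le> ?v (Suc b) a'" using k' by (simp add: k_def)
    with a' show ?thesis using le_trans by blast
  qed
  then obtain a' where a': "a' < items I" "?Z ^ 6 \<le> ?v (Suc b) a'" by blast
  have "?n * (2 * items I * types I + items I + 1) \<le> ?Z * (2 * ?Z * ?Z + ?Z + ?Z)"
    using buyers_less_scale[of I] scale_greater(1,2)[of I]
    by (intro mult_le_mono add_mono) linarith+
  also have "\<dots> \<le> ?Z ^ 6"
  proof -
    have "2 * ?Z * ?Z \<le> ?Z * ?Z * ?Z" using Z2 by (intro mult_le_mono) auto
    then have "2 * ?Z * ?Z \<le> ?Z ^ 3" by (simp add: power3_eq_cube)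
    moreover have "?Z + ?Z \<le> ?Z ^ 2" using mult_le_mono1[OF Z2, of ?Z] unfolding power2_eq_square by linarith
    moreover have "?Z ^ 2 \<le> ?Z ^ 3" using Z2 by (intro power_increasing) auto
    ultimately have "2 * ?Z * ?Z + ?Z + ?Z \<le> 2 * ?Z ^ 3" by linarith
    also have "\<dots> \<le> ?Z * ?Z ^ 3" using Z2 by (rule mult_le_mono1)
    also have "\<dots> = ?Z ^ 4" by (simp flip: power_Suc)
    also have "\<dots> \<le> ?Z ^ 5" using Z2 by (intro power_increasing) auto
    finally have "?Z * (2 * ?Z * ?Z + ?Z + ?Z) \<le> ?Z * ?Z ^ 5" by (rule mult_le_mono2)
    then show ?thesis by (simp flip: power_Suc)
  qed
  also have "\<dots> \<le> prices I ?n a'" using a' final le_trans by blast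
  also have "\<dots> \<le> (\<Sum>a<items I. prices I ?n a)" using a' by (intro member_le_sum) auto
  finally show ?thesis .
qed

section \<open>The approximation ratio\<close>

lemma strategy_vs_plan:
  assumes "valid_market I"
  shows "measure_pmf.expectation (run I \<sigma> (buyers I)) (revenue I) \<le>
    7.92 * measure_pmf.expectation (run I (plan I) (buyers I)) (revenue I)"
proof -
  have nonneg: "0 \<le> measure_pmf.expectation (run I (plan I) (buyers I)) (revenue I)"
    by (rule integral_nonneg_AE) (auto simp: AE_measure_pmf_iff intro: revenue_nonneg[OF assms])
  show ?thesis
  proof (cases "0 < buyers I")
    case False
    then show ?thesis by (simp add: revenue_def)
  next
    case n: True
    show ?thesis
    proof (cases "\<exists>a<items I. \<exists>b<types I. 0 < copies I b \<and> like_prob I a b * price I a b \<noteq> 0")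
      case False
      then have "measure_pmf.expectation (run I \<sigma> (buyers I)) (revenue I) \<le> 0"
        by (intro worthless_revenue[OF assms]) (use n in blast)+
      also have "0 \<le> 7.92 * measure_pmf.expectation (run I (plan I) (buyers I)) (revenue I)"
        using nonneg by simp
      finally show ?thesis .
    next
      case True
      then have "buyers I * (2 * items I * types I + items I + 1) \<le> (\<Sum>a<items I. prices I (buyers I) a)"
        using prices_large[OF assms] by blast
      then have "real (buyers I * (2 * items I * types I + items I + 1)) \<le>
          (\<Sum>a<items I. real (prices I (buyers I) a))"
        by (metis of_nat_le_iff of_nat_sum)
      then have "real (market_scale I ^ 10) * measure_pmf.expectation (run I \<sigma> (buyers I)) (revenue I) \<le>
          4 * (\<Sum>a<items I. real (prices I (buyers I) a))"
        using strategy_revenue_le[OF assms, of \<sigma>] n by linarith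
      also have "\<dots> \<le> 4 * (real (market_scale I ^ 10) * measure_pmf.expectation (run I (plan I) (buyers I)) (revenue I))"
        using plan_revenue[OF assms] n by simp
      finally have "real (market_scale I ^ 10) * measure_pmf.expectation (run I \<sigma> (buyers I)) (revenue I) \<le>
          real (market_scale I ^ 10) * (4 * measure_pmf.expectation (run I (plan I) (buyers I)) (revenue I))"
        by simp
      moreover have "0 < real (market_scale I ^ 10)" using buyers_less_scale[of I] by simp
      ultimately have "measure_pmf.expectation (run I \<sigma> (buyers I)) (revenue I) \<le>
          4 * measure_pmf.expectation (run I (plan I) (buyers I)) (revenue I)"
        by (rule mult_left_le_imp_le)
      also have "\<dots> \<le> 7.92 * measure_pmf.expectation (run I (plan I) (buyers I)) (revenue I)"
        using nonneg by (intro mult_right_mono) auto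
      finally show ?thesis .
    qed
  qed
qed

text \<open>A distribution on strategies may have infinite support, so the finite expectation lemmas
  do not apply to \<open>D\<close>; as revenues are nonnegative, iterated nonnegative integrals do
  the averaging.\<close>

lemma expected_revenue_le:
  assumes "valid_market I" "\<And>\<sigma>. measure_pmf.expectation (run I \<sigma> (buyers I)) (revenue I) \<le> C"
  shows "expected_revenue I D \<le> C"
proof -
  have C: "0 \<le> C"
  proof -
    have "0 \<le> measure_pmf.expectation (run I (plan I) (buyers I)) (revenue I)"
      by (rule integral_nonneg_AE) (auto simp: AE_measure_pmf_iff intro: revenue_nonneg[OF assms(1)])
    also have "\<dots> \<le> C" by (rule assms(2))
    finally show ?thesis .
  qed
  have int: "integrable (run I \<sigma> (buyers I)) (revenue I)" for \<sigma>
    using integrable_revenue[OF assms(1), of "return_pmf \<sigma>"] by (simp add: bind_return_pmf)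
  have "ennreal (expected_revenue I D) = (\<integral>\<^sup>+ h. revenue I h \<partial>bind_pmf D (\<lambda>\<sigma>. run I \<sigma> (buyers I)))"
    unfolding expected_revenue_def
    by (rule nn_integral_eq_integral[symmetric, OF integrable_revenue[OF assms(1)]])
      (auto simp: AE_measure_pmf_iff intro: revenue_nonneg[OF assms(1)])
  also have "\<dots> = (\<integral>\<^sup>+ \<sigma>. \<integral>\<^sup>+ h. revenue I h \<partial>run I \<sigma> (buyers I) \<partial>D)"
    by (rule nn_integral_bind_pmf)
  also have "\<dots> \<le> (\<integral>\<^sup>+ \<sigma>. ennreal C \<partial>D)"
  proof (rule nn_integral_mono)
    fix \<sigma>
    have "(\<integral>\<^sup>+ h. revenue I h \<partial>run I \<sigma> (buyers I)) =
        ennreal (measure_pmf.expectation (run I \<sigma> (buyers I)) (revenue I))"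
      by (rule nn_integral_eq_integral[OF int])
        (auto simp: AE_measure_pmf_iff intro: revenue_nonneg[OF assms(1)])
    also have "\<dots> \<le> ennreal C" by (intro ennreal_leI assms(2))
    finally show "(\<integral>\<^sup>+ h. revenue I h \<partial>run I \<sigma> (buyers I)) \<le> ennreal C" .
  qed
  also have "\<dots> = ennreal C" by simp
  finally show ?thesis using C by (simp add: ennreal_le_iff)
qed

section \<open>The program\<close>

lemma nth_concat_uniform:
  assumes "\<And>xs. xs \<in> set xss \<Longrightarrow> length xs = k" "i < length xss" "j < k"
  shows "concat xss ! (k * i + j) = xss ! i ! j"
  using assms
proof (induction xss arbitrary: i)
  case (Cons xs xss)
  then show ?case by (cases i) (auto simp: nth_append)
qed simp

lemma length_concat_uniform:
  assumes "\<And>xs. xs \<in> set xss \<Longrightarrow> length xs = k"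
  shows "length (concat xss) = k * length xss"
  using assms by (induction xss) auto

lemma load_Suc: "i < length xs \<Longrightarrow> load xs (Suc i) = xs ! i"
  by (simp add: load_def)

lemma load_append1: "i < length xs \<Longrightarrow> load (xs @ ys) (Suc i) = load xs (Suc i)"
  by (simp add: load_def nth_append)

lemma load_append2: "i < length ys \<Longrightarrow> load (xs @ ys) (Suc (length xs + i)) = load ys (Suc i)"
  by (simp add: load_def nth_append)

lemma load_concat:
  assumes "\<And>xs. xs \<in> set xss \<Longrightarrow> length xs = k" "i < length xss" "j < k"
  shows "load (concat xss) (Suc (k * i + j)) = xss ! i ! j"
proof -
  have "k * i + j < k * Suc i" using assms(3) by simp
  also have "\<dots> \<le> k * length xss" using assms(2) by (intro mult_le_mono2) simp
  finally show ?thesis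
    using assms by (simp add: load_Suc length_concat_uniform nth_concat_uniform)
qed

definition item_cells :: "market \<Rightarrow> nat list list" where
  "item_cells I = concat (map (\<lambda>a. map (\<lambda>b.
     [numer (like_prob I a b), denom (like_prob I a b), numer (price I a b), denom (price I a b)])
     [0..<types I]) [0..<items I])"

definition type_cells :: "market \<Rightarrow> nat list list" where
  "type_cells I = map (\<lambda>b. [patience I b, copies I b]) [0..<types I]"

lemma encode_market_cells:
  "encode_market I = [items I, types I] @ concat (item_cells I) @ concat (type_cells I)"
  by (simp add: encode_market_def item_cells_def type_cells_def encode_rat)

lemma length_item_cells: "length (item_cells I) = types I * items I"
  unfolding item_cells_def by (subst length_concat_uniform[where k = "types I"]) auto

lemma length_type_cells: "length (type_cells I) = types I"
  by (simp add: type_cells_def)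

lemma item_cells_nth:
  assumes "a < items I" "b < types I"
  shows "item_cells I ! (types I * a + b) =
    [numer (like_prob I a b), denom (like_prob I a b), numer (price I a b), denom (price I a b)]"
  unfolding item_cells_def
  by (subst nth_concat_uniform) (use assms in auto)

lemma item_cells_length4: "xs \<in> set (item_cells I) \<Longrightarrow> length xs = 4"
  by (auto simp: item_cells_def)

lemma type_cells_length2: "xs \<in> set (type_cells I) \<Longrightarrow> length xs = 2"
  by (auto simp: type_cells_def)

lemma length_encode_market: "length (encode_market I) = 2 + 4 * (types I * items I) + 2 * types I"
  by (simp add: encode_market_cells length_concat_uniform[where k = 4] length_concat_uniform[where k = 2]
      item_cells_length4 type_cells_length2 length_item_cells length_type_cells)

lemma load_items: "load (encode_market I) (Suc 0) = items I"
  and load_types: "load (encode_market I) 2 = types I"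
  by (simp_all add: encode_market_cells load_def)

text \<open>Cell 0 holds the length and cells 1 and 2 the dimensions, so the blocks of four numbers
  begin at cell 3.\<close>

lemma load_item_cells:
  assumes "a < items I" "b < types I" "j < 4"
  shows "load (encode_market I) (3 + j + 4 * (a * types I + b)) =
    [numer (like_prob I a b), denom (like_prob I a b), numer (price I a b), denom (price I a b)] ! j"
proof -
  have i: "types I * a + b < length (item_cells I)"
  proof -
    have "types I * a + b < types I * Suc a" using assms(2) by simp
    also have "\<dots> \<le> types I * items I" using assms(1) by (intro mult_le_mono2) simp
    finally show ?thesis by (simp add: length_item_cells)
  qed
  have "4 * (types I * a + b) + j < length (concat (item_cells I))"
    using i assms(3) by (simp add: length_concat_uniform[where k = 4] item_cells_length4)
  then have "load (encode_market I) (Suc (2 + (4 * (types I * a + b) + j))) =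
      load (concat (item_cells I)) (Suc (4 * (types I * a + b) + j))"
    using load_append2[of "4 * (types I * a + b) + j" "concat (item_cells I) @ concat (type_cells I)"
        "[items I, types I]"]
    by (simp add: encode_market_cells load_append1)
  also have "\<dots> = item_cells I ! (types I * a + b) ! j"
    by (rule load_concat[OF item_cells_length4 i assms(3)])
  also have "Suc (2 + (4 * (types I * a + b) + j)) = 3 + j + 4 * (a * types I + b)" by simp
  finally show ?thesis by (simp only: item_cells_nth[OF assms(1,2)])
qed

lemma load_type_cells:
  assumes "b < types I" "j < 2"
  shows "load (encode_market I) (3 + j + (4 * (items I * types I) + 2 * b)) = [patience I b, copies I b] ! j"
proof -
  have len: "length (concat (item_cells I)) = 4 * (items I * types I)"
    by (simp add: length_concat_uniform[where k = 4] item_cells_length4 length_item_cells)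
  have "2 * b + j < length (concat (type_cells I))"
    using assms by (simp add: length_concat_uniform[where k = 2] type_cells_length2 length_type_cells)
  then have "load (encode_market I) (Suc (2 + 4 * (items I * types I) + (2 * b + j))) =
      load (concat (type_cells I)) (Suc (2 * b + j))"
    using load_append2[of "2 * b + j" "concat (type_cells I)" "[items I, types I] @ concat (item_cells I)"]
    by (simp add: encode_market_cells len flip: append_Cons)
  also have "\<dots> = type_cells I ! b ! j"
    by (rule load_concat) (use assms in \<open>auto simp: type_cells_length2 length_type_cells\<close>)
  also have "Suc (2 + 4 * (items I * types I) + (2 * b + j)) = 3 + j + (4 * (items I * types I) + 2 * b)" by simp
  finally show ?thesis using assms(1) by (simp only: type_cells_def nth_map_upt diff_zero add_0)
qed

lemma length_encode_history: "length (encode_history h) = 3 * length h"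
proof -
  have "length (encode_event e) = 3" for e by (cases e) auto
  then show ?thesis unfolding encode_history_def by (subst length_concat_uniform[where k = 3]) auto
qed

lemma load_history:
  assumes "i < length h" "j < 3"
  shows "load (encode_history h) (Suc (3 * i + j)) = encode_event (h ! i) ! j"
proof -
  have "length (encode_event e) = 3" for e by (cases e) auto
  then show ?thesis unfolding encode_history_def
    by (subst load_concat) (use assms in auto)
qed

text \<open>Arrays 10--14 hold the numbers of buyers and of items, the scale, the number of arrivals and
  the type of the current buyer; 15 and 16 the marks of sold and of declined items. Arrays 17--21
  hold loop counters; 26, 22 and 27 the prices, the value \<open>U\<close> and the marks of the picked items
  in the greedy selection; 23--25 the maximum, the item and the current gain of a scan; 28 the successor of the allowed item picked
  last, for every type.\<close>

definition skip :: com where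
  "skip = Set 29 (Const 0)"

fun Pow :: "expr \<Rightarrow> nat \<Rightarrow> expr" where
  "Pow e 0 = Const 1"
| "Pow e (Suc n) = Mult e (Pow e n)"

lemma val_Pow [simp]: "val (Pow e n) s = val e s ^ n"
  by (induction n) auto

definition item_cell :: "nat \<Rightarrow> expr" where
  "item_cell j = Get 0 (Add (Const (3 + j)) (Mult (Const 4) (Add (Mult (Var 21) (Get 0 (Const 2))) (Var 19))))"

definition type_cell :: "nat \<Rightarrow> expr \<Rightarrow> expr" where
  "type_cell j b = Get 0 (Add (Const (3 + j))
     (Add (Mult (Const 4) (Mult (Get 0 (Const 1)) (Get 0 (Const 2)))) (Mult (Const 2) b)))"

definition count_buyers :: com where
  "count_buyers = For 17 (Get 0 (Const 2)) (Set 10 (Add (Var 10) (type_cell 1 (Var 17))))"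

text \<open>Without types the encoding lists no items, and \<open>items I\<close> is not bounded by
  its length. Division by zero then stores 0; otherwise the quotient is \<open>items I\<close>, so
  the stored count is always polynomial.\<close>

definition count_items :: com where
  "count_items = Set 11 (Quot (Mult (Get 0 (Const 1)) (Get 0 (Const 2))) (Get 0 (Const 2)))"

definition compute_scale :: com where
  "compute_scale = Seq (Set 12 (Add (Const 1) (Var 10)))
     (For 17 (Get 0 (Const 0)) (Set 12 (Mult (Var 12) (Add (Const 1) (Get 0 (Add (Const 1) (Var 17)))))))"

definition history_cell :: "nat \<Rightarrow> expr" where
  "history_cell j = Get 1 (Add (Const (Suc j)) (Mult (Const 3) (Var 17)))"

text \<open>The event codes 0, 1, 2 stand for arrival, refusal and sale; subtracting 1 separates the
  last two. A refusal is stamped with the number of arrivals so far.\<close>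

definition read_history :: com where
  "read_history = For 17 (Quot (Get 1 (Const 0)) (Const 3))
     (If (history_cell 0)
       (If (Monus (history_cell 0) (Const 1))
         (Assign 15 (history_cell 2) (Const 1))
         (Assign 16 (history_cell 2) (Var 13)))
       (Seq (Set 13 (Add (Var 13) (Const 1))) (Set 14 (history_cell 1))))"

text \<open>The factor from array 27 disables picked items; this agrees with their value 0 in
  \<open>scan\<close>, which never exceeds the maximum so far.\<close>

definition scan_com :: com where
  "scan_com = Seq (Set 23 (Const 0)) (Seq (Set 24 (Const 0))
     (For 21 (Var 11)
       (Seq (Set 25 (Quot (Mult (item_cell 0)
              (Monus (Monus (Quot (Mult (Pow (Var 12) 10) (item_cell 2)) (item_cell 3)) (Get 26 (Var 21))) (Var 22)))
              (item_cell 1)))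
         (If (Mult (Monus (Var 25) (Var 23)) (Monus (Const 1) (Get 27 (Var 21))))
           (Seq (Set 23 (Var 25)) (Set 24 (Var 21)))
           skip))))"

text \<open>The list itself is never stored. The latest pick is its head, so overwriting the entry
  in array 28 at every allowed pick leaves the first allowed item of the finished list.\<close>

definition pick_com :: com where
  "pick_com = Seq scan_com
     (If (Var 23)
       (Seq (Assign 27 (Var 24) (Const 1))
       (Seq (Set 22 (Add (Var 22) (Var 23)))
       (Seq (Assign 26 (Var 24) (Add (Get 26 (Var 24)) (Quot (Mult (type_cell 1 (Var 19)) (Var 23)) (Var 10))))
         (If (Mult (Monus (Const 1) (Get 15 (Var 24))) (Monus (Var 13) (Get 16 (Var 24))))
           (Assign 28 (Var 19) (Add (Var 24) (Const 1)))
           skip))))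
       skip)"

text \<open>The double truncated subtraction computes a minimum: patience is given in binary and may
  be exponentially large, but only as many rounds as items are run.\<close>

definition greedy_com :: com where
  "greedy_com = Seq (Set 22 (Const 0)) (Seq (Assign 28 (Var 19) (Const 0))
     (Seq (For 21 (Var 11) (Assign 27 (Var 21) (Const 0)))
       (For 20 (Monus (Var 11) (Monus (Var 11) (type_cell 0 (Var 19)))) pick_com)))"

text \<open>Pass \<open>t\<close> computes the decisions for \<open>t\<close> buyers still to come
  and then the prices for \<open>t + 1\<close>. Counting from 0, the pass for
  \<open>buyers I - i\<close> is the last one, which explains the added 1.\<close>

definition plan_com :: com where
  "plan_com = Seq count_buyers (Seq count_items (Seq compute_scale (Seq read_history
     (Seq (For 18 (Add (Const 1) (Monus (Var 10) (Var 13))) (For 19 (Get 0 (Const 2)) greedy_com))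
       (Set 3 (Get 28 (Var 14)))))))"

section \<open>Size of the stored numbers\<close>

lemma scaled_price_less:
  assumes "a < items I" "b < types I"
  shows "scaled_price I a b < market_scale I ^ 11"
proof -
  have "scaled_price I a b \<le> market_scale I ^ 10 * numer (price I a b)"
    unfolding scaled_price_def by (rule div_le_dividend)
  also have "\<dots> < market_scale I ^ 10 * market_scale I"
    using scale_greater(5)[OF assms] by (intro mult_less_mono2) auto
  finally show ?thesis by (simp flip: power_Suc2)
qed

text \<open>A gain is at most the room that the price and \<open>U\<close> leave below the scaled
  price, so neither can pass the largest scaled price. The bound is therefore independent of the
  number of rounds, and the lengths do not build up over time.\<close>

lemma greedy_less:
  assumes "valid_market I" "b < types I" "\<And>a. v a < market_scale I ^ 11" "greedy I b v k = (v', U, P)"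
  shows "v' a < market_scale I ^ 11" "U < market_scale I ^ 11"
proof -
  have "(\<forall>a. v' a < market_scale I ^ 11) \<and> U < market_scale I ^ 11"
    using assms(4)
  proof (induction k arbitrary: v' U P)
    case 0
    then show ?case using assms(3) buyers_less_scale[of I] by (auto simp: greedy_0)
  next
    case (Suc k)
    obtain v'' U'' P'' where g: "greedy I b v k = (v'', U'', P'')" by (metis prod_cases3)
    note IH = Suc.IH[OF g]
    show ?case
    proof (cases rule: pick_cases[of I b v'' U'' P''])
      case none
      then show ?thesis using IH Suc.prems by (simp add: greedy_Suc g)
    next
      case (some a)
      let ?x = "gain I b v'' U'' a"
      have x: "?x \<le> scaled_price I a b - v'' a - U''" by (rule gain_bounds(3)[OF assms(1) some(2) assms(2)])
      have "copies I b * ?x div buyers I \<le> ?x"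
      proof (cases "buyers I = 0")
        case False
        have "copies I b * ?x div buyers I \<le> buyers I * ?x div buyers I"
          using buyer_copies_le[OF assms(2)] by (intro div_le_mono mult_le_mono1)
        then show ?thesis using False by simp
      qed simp
      with x some(4) scaled_price_less[OF some(2) assms(2)]
      have "v'' a + copies I b * ?x div buyers I < market_scale I ^ 11" "U'' + ?x < market_scale I ^ 11"
        by linarith+
      then show ?thesis using IH Suc.prems some(1) by (auto simp: greedy_Suc g)
    qed
  qed
  then show "v' a < market_scale I ^ 11" "U < market_scale I ^ 11" by auto
qed

lemma prices_within_less:
  assumes "valid_market I" "\<And>a. v a < market_scale I ^ 11" "b \<le> types I"
  shows "prices_within I v b a < market_scale I ^ 11"
  using assms(3)
proof (induction b arbitrary: a)
  case (Suc b)
  obtain v' U P where "greedy I b (prices_within I v b) (picks I b) = (v', U, P)" by (metis prod_cases3)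
  from greedy_less(1)[OF assms(1) _ _ this, of a] Suc this show ?case by simp
qed (use assms in simp)

lemma prices_less: "valid_market I \<Longrightarrow> prices I j a < market_scale I ^ 11"
proof (induction j arbitrary: a)
  case 0
  then show ?case using buyers_less_scale[of I] by simp
qed (simp add: prices_within_less)

section \<open>Correctness of the selection loops\<close>

locale plan_program =
  fixes I :: market and h :: history and X L :: nat
  assumes valid: "valid_market I"
    and X: "types I \<le> X" "items I * types I div types I \<le> X" "Suc (buyers I) \<le> X"
      "length (encode_market I) \<le> X" "length h \<le> X"
    and L: "market_scale I ^ 11 < 2 ^ L" "X < 2 ^ L" "load (encode_history h) i < 2 ^ L"
begin

abbreviation "selected \<equiv> \<lambda>P. encode_decision (find (allowed h) P)"

lemma less_L: "x \<le> X \<Longrightarrow> x < 2 ^ L"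
  using L(2) by simp

definition ready :: "store \<Rightarrow> bool" where
  "ready s \<longleftrightarrow> s 0 = load (encode_market I) \<and> s 10 0 = buyers I \<and>
     s 11 0 = items I * types I div types I \<and> s 12 0 = market_scale I \<and>
     (s 13 0, s 14 0, s 15, s 16) = observed h"

text \<open>\<open>d\<close> holds the decisions as they were before the selection for type
  \<open>b\<close>; only entry \<open>b\<close> follows the growing list.\<close>

definition progressing :: "nat \<Rightarrow> nat \<Rightarrow> progress \<Rightarrow> (nat \<Rightarrow> nat) \<Rightarrow> store \<Rightarrow> bool" where
  "progressing t b = (\<lambda>(v, U, P) d s. ready s \<and> s 18 0 = t \<and> s 19 0 = b \<and> s 26 = v \<and> s 22 0 = U \<and>
     (\<forall>a<items I. s 27 a = of_bool (a \<in> set P)) \<and> s 28 = d(b := selected P))"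

lemma ready_upd [simp]: "x \<notin> {0, 10, 11, 12, 13, 14, 15, 16} \<Longrightarrow> ready (s(x := f)) = ready s"
  by (simp add: ready_def)

lemma progressing_upd [simp]:
  "x \<notin> {0, 10, 11, 12, 13, 14, 15, 16, 18, 19, 22, 26, 27, 28} \<Longrightarrow>
    progressing t b q d (s(x := f)) = progressing t b q d s"
  by (cases q) (simp add: progressing_def ready_def)

lemma val_item_cell:
  assumes "ready s" "s 21 0 < items I" "s 19 0 < types I" "j < 4"
  shows "val (item_cell j) s = [numer (like_prob I (s 21 0) (s 19 0)), denom (like_prob I (s 21 0) (s 19 0)),
    numer (price I (s 21 0) (s 19 0)), denom (price I (s 21 0) (s 19 0))] ! j"
proof -
  have "s 0 2 = types I" using assms(1) by (simp add: ready_def load_types)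
  then show ?thesis
    using assms(1) load_item_cells[OF assms(2,3,4)] by (simp add: item_cell_def ready_def)
qed

lemma val_type_cell:
  assumes "s 0 = load (encode_market I)" "val e s < types I" "j < 2"
  shows "val (type_cell j e) s = [patience I (val e s), copies I (val e s)] ! j"
  using assms(1) load_type_cells[OF assms(2,3)]
  by (simp add: type_cell_def load_items load_types)

lemma ready_items: "ready s \<Longrightarrow> b < types I \<Longrightarrow> s 11 0 = items I"
  by (auto simp: ready_def)

lemma items_le: "b < types I \<Longrightarrow> items I \<le> X"
  using X(2) by auto

lemma wp_skip: "(\<And>f. Q (s(29 := f))) \<Longrightarrow> wp L X d skip Q s"
  unfolding skip_def by (rule wp_Assign) auto

lemma wp_scan:
  assumes b: "b < types I" and p: "progressing t b (v, U, P) d s" and k: "s 20 0 = k"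
  shows "wp L X 1 scan_com (\<lambda>s. progressing t b (v, U, P) d s \<and> s 20 0 = k \<and>
    (s 23 0, s 24 0) = scan (\<lambda>a. if a \<in> set P then 0 else gain I b v U a) (items I)) s"
proof -
  let ?f = "\<lambda>a. if a \<in> set P then 0 else gain I b v U a"
  let ?P = "\<lambda>i s. progressing t b (v, U, P) d s \<and> s 20 0 = k \<and> (s 23 0, s 24 0) = scan ?f i"
  have "wp L X (Suc 0) scan_com (?P (items I)) s"
    unfolding scan_com_def
  proof (rule wp_Seq, rule wp_Assign, simp, rule wp_Seq, rule wp_Assign, simp, rule wp_For)
    show "items I \<le> X" "items I < 2 ^ L" using items_le[OF b] less_L by auto
  next
    fix i s assume "?P i s"
    then show "val (Var 11) s = items I" using ready_items[OF _ b] by (simp add: progressing_def)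
  next
    fix a s assume P: "?P a s" and a: "s 21 0 = a" "a < items I"
    then have s: "ready s" "s 19 0 = b" "s 26 = v" "s 22 0 = U" "s 12 0 = market_scale I"
        "s 27 a = of_bool (a \<in> set P)"
      by (simp_all add: progressing_def ready_def)
    note cells = val_item_cell[OF s(1), unfolded a(1) s(2), OF a(2) b]
    let ?e = "Quot (Mult (item_cell 0) (Monus (Monus (Quot (Mult (Pow (Var 12) 10) (item_cell 2)) (item_cell 3))
      (Get 26 (Var 21))) (Var 22))) (item_cell 1)"
    obtain e where e: "e = ?e" by blast
    have g: "val e s = gain I b v U a"
      by (simp add: e cells s a gain_def scaled_price_def)
    have "gain I b v U a < 2 ^ L"
      using gain_bounds(3)[OF valid a(2) b, of v U] scaled_price_less[OF a(2) b] L(1) by linarith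
    moreover have "a < 2 ^ L" using a(2) items_le[OF b] less_L by simp
    ultimately show "wp L X 0 (Seq (Set 25 ?e)
        (If (Mult (Monus (Var 25) (Var 23)) (Monus (Const 1) (Get 27 (Var 21))))
          (Seq (Set 23 (Var 25)) (Set 24 (Var 21))) skip))
      (\<lambda>s. s 21 0 = a \<and> ?P (Suc a) (s(21 := (s 21)(0 := Suc a)))) s"
      unfolding e[symmetric] using P s a
      by (intro wp_Seq wp_Assign wp_If wp_skip) (auto simp: g prod_eq_iff simp del: One_nat_def)
  qed (use p k in \<open>simp add: fun_upd_other del: fun_upd_apply; simp\<close>)
  then show ?thesis by simp
qed

lemma wp_pick:
  assumes b: "b < types I" and p: "progressing t b q d s" and k: "s 20 0 = k"
    and less: "\<And>a. fst (pick I b q) a < 2 ^ L" "fst (snd (pick I b q)) < 2 ^ L"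
  shows "wp L X 1 pick_com (\<lambda>s. progressing t b (pick I b q) d s \<and> s 20 0 = k) s"
proof -
  obtain v U P where q: "q = (v, U, P)" by (metis prod_cases3)
  obtain x a where xa: "scan (\<lambda>a. if a \<in> set P then 0 else gain I b v U a) (items I) = (x, a)" by fastforce
  show ?thesis
    unfolding pick_com_def
  proof (rule wp_Seq, rule wp_mono[OF wp_scan[OF b p[unfolded q] k]])
    fix s assume *: "progressing t b (v, U, P) d s \<and> s 20 0 = k \<and>
      (s 23 0, s 24 0) = scan (\<lambda>a. if a \<in> set P then 0 else gain I b v U a) (items I)"
    then have s: "ready s" "s 19 0 = b" "s 18 0 = t" "s 26 = v" "s 22 0 = U" "s 10 0 = buyers I" "s 20 0 = k"
        "s 23 0 = x" "s 24 0 = a" "s 0 = load (encode_market I)" "\<forall>a<items I. s 27 a = of_bool (a \<in> set P)"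
        "s 28 = d(b := selected P)"
      by (simp_all add: progressing_def ready_def xa)
    show "wp L X 1 (If (Var 23)
       (Seq (Assign 27 (Var 24) (Const 1))
       (Seq (Set 22 (Add (Var 22) (Var 23)))
       (Seq (Assign 26 (Var 24) (Add (Get 26 (Var 24)) (Quot (Mult (type_cell 1 (Var 19)) (Var 23)) (Var 10))))
         (If (Mult (Monus (Const 1) (Get 15 (Var 24))) (Monus (Var 13) (Get 16 (Var 24))))
           (Assign 28 (Var 19) (Add (Var 24) (Const 1)))
           skip))))
       skip) (\<lambda>s. progressing t b (pick I b q) d s \<and> s 20 0 = k) s"
    proof (rule wp_If)
      assume "val (Var 23) s = 0"
      then have "pick I b q = q" using s by (simp add: q pick_def xa)
      then show "wp L X 1 skip (\<lambda>s. progressing t b (pick I b q) d s \<and> s 20 0 = k) s"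
        using * by (intro wp_skip) (simp add: q)
    next
      assume "val (Var 23) s \<noteq> 0"
      then have x: "x \<noteq> 0" using s by simp
      then have a: "a < items I" "a \<notin> set P"
        using scan_arg[of "\<lambda>a. if a \<in> set P then 0 else gain I b v U a" "items I"] xa by (auto split: if_splits)
      have pk: "pick I b q = (v(a := v a + copies I b * x div buyers I), U + x, a # P)"
        using x by (simp add: q pick_def xa)
      have val: "val (type_cell 1 (Var 19)) s' = copies I b" if "s' 0 = s 0" "s' 19 = s 19" for s'
        using val_type_cell[of s' "Var 19" 1] that s b by simp
      have al: "allowed h a \<longleftrightarrow> Suc 0 - s 15 a \<noteq> 0 \<and> s 13 0 - s 16 a \<noteq> 0"
        using s(1) by (auto simp: allowed_def ready_def split: prod.splits)
      have less': "v a + copies I b * x div buyers I < 2 ^ L" "U + x < 2 ^ L" "Suc a < 2 ^ L"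
        using less(1)[of a] less(2) a items_le[OF b] less_L by (auto simp: pk)
      define s' where "s' = s(27 := (s 27)(a := 1), 22 := (s 22)(0 := U + x),
        26 := v(a := v a + copies I b * x div buyers I))"
      have yes: "progressing t b (pick I b q) d (s'(28 := (s 28)(b := Suc a)))" if "allowed h a"
        using s a that by (simp add: progressing_def pk s'_def ready_def)
      have no: "progressing t b (pick I b q) d (s'(x := f))" if "\<not> allowed h a" "x = 29" for x f
        using s a that by (simp add: progressing_def pk s'_def ready_def)
      have "wp L X 1 (If (Mult (Monus (Const 1) (Get 15 (Var 24))) (Monus (Var 13) (Get 16 (Var 24))))
           (Assign 28 (Var 19) (Add (Var 24) (Const 1))) skip)
           (\<lambda>s. progressing t b (pick I b q) d s \<and> s 20 0 = k) s'"
      proof (rule wp_If)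
        assume "val (Mult (Monus (Const 1) (Get 15 (Var 24))) (Monus (Var 13) (Get 16 (Var 24)))) s' \<noteq> 0"
        then have "allowed h a" using s by (simp add: al s'_def)
        with s yes less' show "wp L X 1 (Assign 28 (Var 19) (Add (Var 24) (Const 1)))
            (\<lambda>s. progressing t b (pick I b q) d s \<and> s 20 0 = k) s'"
          by (intro wp_Assign) (simp_all add: s'_def)
      next
        assume "val (Mult (Monus (Const 1) (Get 15 (Var 24))) (Monus (Var 13) (Get 16 (Var 24)))) s' = 0"
        then have "\<not> allowed h a" using s by (simp add: al s'_def)
        with no s show "wp L X 1 skip (\<lambda>s. progressing t b (pick I b q) d s \<and> s 20 0 = k) s'"
          by (intro wp_skip) (simp add: s'_def)
      qed
      then show "wp L X 1
       (Seq (Assign 27 (Var 24) (Const 1))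
       (Seq (Set 22 (Add (Var 22) (Var 23)))
       (Seq (Assign 26 (Var 24) (Add (Get 26 (Var 24)) (Quot (Mult (type_cell 1 (Var 19)) (Var 23)) (Var 10))))
         (If (Mult (Monus (Const 1) (Get 15 (Var 24))) (Monus (Var 13) (Get 16 (Var 24))))
           (Assign 28 (Var 19) (Add (Var 24) (Const 1)))
           skip)))) (\<lambda>s. progressing t b (pick I b q) d s \<and> s 20 0 = k) s"
        using s less'
        by (intro wp_Seq wp_Assign) (simp_all add: val s'_def del: One_nat_def)
    qed
  qed
qed


lemma wp_greedy:
  assumes b: "b < types I" and v: "\<And>a. v a < market_scale I ^ 11"
    and s: "ready s" "s 18 0 = t" "s 19 0 = b" "s 26 = v" "s 28 = d"
  shows "wp L X 2 greedy_com (\<lambda>s. ready s \<and> s 18 0 = t \<and> s 19 0 = b \<and> s 26 = fst (greedy I b v (picks I b)) \<and>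
    s 28 = d(b := selected (snd (snd (greedy I b v (picks I b)))))) s"
proof -
  let ?P = "\<lambda>k. progressing t b (greedy I b v k) d"
  let ?clear = "For 21 (Var 11) (Assign 27 (Var 21) (Const 0))"
  let ?s = "s(22 := (s 22)(0 := 0), 28 := d(b := 0))"
  have bnd: "items I \<le> X" "items I < 2 ^ L" using items_le[OF b] less_L by auto
  have less: "fst (greedy I b v k) a < 2 ^ L" "fst (snd (greedy I b v k)) < 2 ^ L" for k a
  proof -
    obtain v' U P where g: "greedy I b v k = (v', U, P)" by (metis prod_cases3)
    show "fst (greedy I b v k) a < 2 ^ L" "fst (snd (greedy I b v k)) < 2 ^ L"
      using greedy_less[OF valid b v g] L(1) less_trans by (auto simp: g)
  qed
  have clear: "wp L X (Suc 1) ?clear (?P 0) ?s"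
  proof (rule wp_mono[OF wp_For[where n = "items I" and P = "\<lambda>i s. ready s \<and> s 18 0 = t \<and> s 19 0 = b \<and>
      s 26 = v \<and> s 28 = d(b := 0) \<and> s 22 0 = 0 \<and> (\<forall>a<i. s 27 a = 0)"]])
    fix i s assume P: "ready s \<and> s 18 0 = t \<and> s 19 0 = b \<and>
      s 26 = v \<and> s 28 = d(b := 0) \<and> s 22 0 = 0 \<and> (\<forall>a<i. s 27 a = 0)"
    then show "val (Var 11) s = items I" using ready_items[OF _ b] by simp
    assume "s 21 0 = i"
    with P show "wp L X 1 (Assign 27 (Var 21) (Const 0)) (\<lambda>s. s 21 0 = i \<and>
      ready (s(21 := (s 21)(0 := Suc i))) \<and> (s(21 := (s 21)(0 := Suc i))) 18 0 = t \<and>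
      (s(21 := (s 21)(0 := Suc i))) 19 0 = b \<and> (s(21 := (s 21)(0 := Suc i))) 26 = v \<and>
      (s(21 := (s 21)(0 := Suc i))) 28 = d(b := 0) \<and> (s(21 := (s 21)(0 := Suc i))) 22 0 = 0 \<and>
      (\<forall>a<Suc i. (s(21 := (s 21)(0 := Suc i))) 27 a = 0)) s"
      by (intro wp_Assign) (auto simp: less_Suc_eq)
  qed (use s bnd in \<open>auto simp: progressing_def greedy_0\<close>)
  have "wp L X (Suc 1) (For 20 (Monus (Var 11) (Monus (Var 11) (type_cell 0 (Var 19)))) pick_com)
      (?P (picks I b)) s" if "?P 0 s" for s
  proof (rule wp_For)
    show "picks I b \<le> X" "picks I b < 2 ^ L" using bnd by (auto simp: picks_def)
    fix k s assume P: "?P k s"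
    then have s: "ready s" "s 19 0 = b" by (cases "greedy I b v k", simp add: progressing_def)+
    show "val (Monus (Var 11) (Monus (Var 11) (type_cell 0 (Var 19)))) s = picks I b"
      using val_type_cell[of s "Var 19" 0] s b ready_items[OF s(1) b] by (simp add: picks_def ready_def)
    assume k: "s 20 0 = k"
    show "wp L X 1 pick_com (\<lambda>s. s 20 0 = k \<and> ?P (Suc k) (s(20 := (s 20)(0 := Suc k)))) s"
      by (rule wp_mono[OF wp_pick[OF b P k]]) (use less[of "Suc k"] in \<open>simp_all add: greedy_Suc\<close>)
  qed (use that in \<open>simp add: fun_upd_other del: fun_upd_apply\<close>)
  then have "wp L X (Suc 1) (For 20 (Monus (Var 11) (Monus (Var 11) (type_cell 0 (Var 19)))) pick_com)
      (\<lambda>s. ready s \<and> s 18 0 = t \<and> s 19 0 = b \<and> s 26 = fst (greedy I b v (picks I b)) \<and>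
        s 28 = d(b := selected (snd (snd (greedy I b v (picks I b)))))) s" if "?P 0 s" for s
    by (rule wp_mono[OF _ _]) (use that in \<open>auto simp: progressing_def split: prod.splits\<close>)
  with clear have "wp L X 2 (Seq ?clear (For 20 (Monus (Var 11) (Monus (Var 11) (type_cell 0 (Var 19)))) pick_com))
      (\<lambda>s. ready s \<and> s 18 0 = t \<and> s 19 0 = b \<and> s 26 = fst (greedy I b v (picks I b)) \<and>
        s 28 = d(b := selected (snd (snd (greedy I b v (picks I b)))))) ?s"
    unfolding numeral_2_eq_2 One_nat_def by (intro wp_Seq) (erule wp_mono)
  then show ?thesis
    unfolding greedy_com_def by (intro wp_Seq[of _ _ _ "Set 22 (Const 0)"] wp_Seq[of _ _ _ "Assign 28 (Var 19) (Const 0)"] wp_Assign) (simp_all add: s)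
qed

lemma wp_main:
  assumes "ready s" "s 26 = (\<lambda>_. 0)" "s 28 = (\<lambda>_. 0)" "observed h = (i, c, sold, declined)"
  shows "wp L X 4 (For 18 (Add (Const 1) (Monus (Var 10) (Var 13))) (For 19 (Get 0 (Const 2)) greedy_com))
    (\<lambda>s. ready s \<and> s 28 c = encode_decision (plan I h)) s"
proof -
  \<comment> \<open>Entries from \<open>types I\<close> on stay 0, the code of \<open>None\<close>,
    which is the right answer after an arrival of an impossible type.\<close>
  define Q where "Q = (\<lambda>t b s. ready s \<and> s 26 = prices_within I (prices I t) b \<and>
    (\<forall>b'<b. s 28 b' = selected (showlist I t b')) \<and> (\<forall>b'\<ge>types I. s 28 b' = 0))"
  \<comment> \<open>After \<open>t\<close> passes the prices are those for \<open>t\<close> buyers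
    to come, but the decisions still belong to \<open>t - 1\<close>.\<close>
  define P where "P = (\<lambda>t s. ready s \<and> s 26 = prices I t \<and>
    (0 < t \<longrightarrow> (\<forall>b'<types I. s 28 b' = selected (showlist I (t - 1) b'))) \<and> (\<forall>b'\<ge>types I. s 28 b' = 0))"
  have Q_upd: "Q t b (s(x := f)) = Q t b s" if "x \<in> {18, 19}" for t b s x f
    using that by (auto simp: Q_def)
  have P_upd: "P t (s(18 := f)) = P t s" for t s f
    by (auto simp: P_def)
  have inner: "wp L X (Suc 2) (For 19 (Get 0 (Const 2)) greedy_com)
      (\<lambda>s. s 18 0 = t \<and> Q t (types I) s) s" if "s 18 0 = t" "P t s" for t s
  proof (rule wp_For)
    show "types I \<le> X" "types I < 2 ^ L" using X(1) less_L by auto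
  next
    fix b s assume *: "s 18 0 = t \<and> Q t b s"
    then show "val (Get 0 (Const 2)) s = types I" by (simp add: Q_def ready_def load_types)
    assume b: "s 19 0 = b" "b < types I"
    have v: "prices_within I (prices I t) b a < market_scale I ^ 11" for a
      using b(2) by (intro prices_within_less valid prices_less) simp
    show "wp L X 2 greedy_com (\<lambda>s. s 19 0 = b \<and> (s(19 := (s 19)(0 := Suc b))) 18 0 = t \<and>
        Q t (Suc b) (s(19 := (s 19)(0 := Suc b)))) s"
    proof (rule wp_mono[OF wp_greedy[where b = b and v = "prices_within I (prices I t) b" and s = s and t = t and d = "s 28"]])
      fix s' assume s': "ready s' \<and> s' 18 0 = t \<and> s' 19 0 = b \<and>
        s' 26 = fst (greedy I b (prices_within I (prices I t) b) (picks I b)) \<and>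
        s' 28 = (s 28)(b := selected (snd (snd (greedy I b (prices_within I (prices I t) b) (picks I b)))))"
      then have "Q t (Suc b) s'"
        using * b(2) by (simp add: Q_def showlist_def less_Suc_eq)
      with s' show "s' 19 0 = b \<and> (s'(19 := (s' 19)(0 := Suc b))) 18 0 = t \<and>
          Q t (Suc b) (s'(19 := (s' 19)(0 := Suc b)))"
        by (simp add: Q_upd)
    qed (use * b v in \<open>simp_all add: Q_def\<close>)
  qed (use that in \<open>simp add: Q_upd P_upd fun_upd_other del: fun_upd_apply; simp add: P_def Q_def\<close>)
  have "wp L X (Suc (Suc 2)) (For 18 (Add (Const 1) (Monus (Var 10) (Var 13)))
      (For 19 (Get 0 (Const 2)) greedy_com)) (P (Suc (buyers I - i))) s"
  proof (rule wp_For)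
    show "Suc (buyers I - i) \<le> X" "Suc (buyers I - i) < 2 ^ L" using X(3) less_L by auto
  next
    fix t s assume *: "P t s"
    then show "val (Add (Const 1) (Monus (Var 10) (Var 13))) s = Suc (buyers I - i)"
      using assms(4) by (simp add: P_def ready_def)
    assume "s 18 0 = t"
    from inner[OF this *] show "wp L X (Suc 2) (For 19 (Get 0 (Const 2)) greedy_com)
        (\<lambda>s. s 18 0 = t \<and> P (Suc t) (s(18 := (s 18)(0 := Suc t)))) s"
      by (rule wp_mono) (simp add: P_upd, simp add: P_def Q_def)
  qed (use assms in \<open>simp add: P_upd fun_upd_other del: fun_upd_apply; simp add: P_def\<close>)
  then have "wp L X (Suc (Suc 2)) (For 18 (Add (Const 1) (Monus (Var 10) (Var 13)))
      (For 19 (Get 0 (Const 2)) greedy_com)) (\<lambda>s. ready s \<and> s 28 c = encode_decision (plan I h)) s"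
    by (rule wp_mono) (auto simp: P_def plan_def assms(4))
  then show ?thesis by simp
qed

lemma selected_less: "encode_decision (plan I h) < 2 ^ L"
proof -
  obtain i c sold d where o: "observed h = (i, c, sold, d)" by (metis prod_cases4)
  show ?thesis
  proof (cases "plan I h")
    case (Some a)
    then have "a \<in> set (showlist I (buyers I - i) c)" "c < types I"
      by (auto simp: plan_def o find_Some_iff split: if_splits)
    then have "Suc a \<le> X" using showlist_props(1) items_le[of c] by fastforce
    then show ?thesis using Some less_L by simp
  qed simp
qed

end

section \<open>Reading the market and the history\<close>

lemma prod_list_take_le: "(\<Prod>x\<leftarrow>take i xs. 1 + x) \<le> (\<Prod>x\<leftarrow>xs. 1 + (x::nat))"
proof -
  have "(\<Prod>x\<leftarrow>xs. 1 + x) = (\<Prod>x\<leftarrow>take i xs. 1 + x) * (\<Prod>x\<leftarrow>drop i xs. 1 + x)"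
    by (metis append_take_drop_id map_append prod_list.append)
  then show ?thesis using prod_list_pos[of "drop i xs"] by simp
qed

lemma observed_arrivals_le: "fst (observed h) \<le> length h"
proof (induction h rule: rev_induct)
  case (snoc e h)
  then show ?case by (cases "observed h"; cases e) auto
qed simp

context plan_program
begin

definition input :: "store \<Rightarrow> bool" where
  "input s \<longleftrightarrow> s 0 = load (encode_market I) \<and> s 1 = load (encode_history h)"

text \<open>Array 17 is exempt because the three initial loops share it as their counter.\<close>

definition blank :: "nat set \<Rightarrow> store \<Rightarrow> bool" where
  "blank A s \<longleftrightarrow> (\<forall>x. x \<notin> A \<and> x \<notin> {0, 1, 17} \<longrightarrow> s x = (\<lambda>_. 0))"

lemma input_upd [simp]: "x \<notin> {0, 1} \<Longrightarrow> input (s(x := f)) = input s"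
  by (simp add: input_def)

lemma blank_upd [simp]: "x \<in> A \<Longrightarrow> blank A (s(x := f)) = blank A s" "blank A (s(17 := f)) = blank A s"
  by (auto simp: blank_def)

lemma blank_mono: "blank A s \<Longrightarrow> A \<subseteq> B \<Longrightarrow> blank B s"
  by (auto simp: blank_def)

lemma scale_less_L: "market_scale I < 2 ^ L"
proof -
  have "market_scale I ^ 1 \<le> market_scale I ^ 11" using buyers_less_scale[of I] by (intro power_increasing) auto
  then show ?thesis using L(1) by simp
qed

lemma wp_count_buyers:
  assumes "input s" "blank {} s"
  shows "wp L X 1 count_buyers (\<lambda>s. input s \<and> blank {10} s \<and> s 10 0 = buyers I) s"
proof -
  define P where "P = (\<lambda>i s. input s \<and> blank {10} s \<and> s 10 0 = (\<Sum>b<i. copies I b))"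
  have upd: "P i (s(17 := f)) = P i s" for i s f by (simp add: P_def)
  have "wp L X (Suc 0) count_buyers (P (types I)) s"
    unfolding count_buyers_def
  proof (rule wp_For)
    show "types I \<le> X" "types I < 2 ^ L" using X(1) less_L by auto
  next
    fix i s assume *: "P i s"
    then show "val (Get 0 (Const 2)) s = types I" by (simp add: P_def input_def load_types)
    assume i: "s 17 0 = i" "i < types I"
    have v: "val (type_cell 1 (Var 17)) s = copies I i"
      using val_type_cell[of s "Var 17" 1] * i by (simp add: P_def input_def)
    have le: "(\<Sum>b<i. copies I b) + copies I i \<le> buyers I"
      using i(2) sum_mono2[of "{..<types I}" "{..<Suc i}" "copies I"] by (simp add: buyers_def)
    show "wp L X 0 (Set 10 (Add (Var 10) (type_cell 1 (Var 17))))
        (\<lambda>s. s 17 0 = i \<and> P (Suc i) (s(17 := (s 17)(0 := Suc i)))) s"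
      unfolding upd
      by (rule wp_Assign) (use * v le i X(3) less_L in \<open>auto simp: P_def\<close>)
  qed (use assms in \<open>simp add: upd fun_upd_other del: fun_upd_apply; simp add: P_def blank_def\<close>)
  then show ?thesis by (simp add: P_def buyers_def)
qed

lemma wp_count_items:
  assumes "input s" "blank {10} s" "s 10 0 = buyers I"
  shows "wp L X d count_items (\<lambda>s. input s \<and> blank {10, 11} s \<and> s 10 0 = buyers I \<and>
    s 11 0 = items I * types I div types I) s"
  unfolding count_items_def using assms X(2) less_L
  by (intro wp_Assign) (auto simp: load_items load_types input_def blank_def)

lemma wp_compute_scale:
  assumes "input s" "blank {10, 11} s" "s 10 0 = buyers I" "s 11 0 = items I * types I div types I"
  shows "wp L X 1 compute_scale (\<lambda>s. input s \<and> blank {10, 11, 12} s \<and> s 10 0 = buyers I \<and>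
    s 11 0 = items I * types I div types I \<and> s 12 0 = market_scale I) s"
proof -
  define part where "part = (\<lambda>i. (1 + buyers I) * (\<Prod>x\<leftarrow>take i (encode_market I). 1 + x))"
  define P where "P = (\<lambda>i s. input s \<and> blank {10, 11, 12} s \<and> s 10 0 = buyers I \<and>
    s 11 0 = items I * types I div types I \<and> s 12 0 = part i)"
  have part: "part i < 2 ^ L" for i
  proof -
    have "part i \<le> market_scale I" unfolding part_def market_scale_def by (intro mult_le_mono prod_list_take_le) simp
    then show ?thesis using scale_less_L by simp
  qed
  have upd: "P i (s(17 := f)) = P i s" for i s f by (simp add: P_def)
  have loop: "wp L X (Suc 0) (For 17 (Get 0 (Const 0))
      (Set 12 (Mult (Var 12) (Add (Const 1) (Get 0 (Add (Const 1) (Var 17)))))))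
      (P (length (encode_market I))) s" if "P 0 s" for s
  proof (rule wp_For)
    show "length (encode_market I) \<le> X" "length (encode_market I) < 2 ^ L" using X(4) less_L by auto
  next
    fix i s assume *: "P i s"
    then show "val (Get 0 (Const 0)) s = length (encode_market I)"
      by (simp add: P_def input_def load_def)
    assume i: "s 17 0 = i" "i < length (encode_market I)"
    have v: "val (Mult (Var 12) (Add (Const 1) (Get 0 (Add (Const 1) (Var 17))))) s = part (Suc i)"
      using * i by (simp add: P_def input_def load_Suc part_def take_Suc_conv_app_nth algebra_simps)
    show "wp L X 0 (Set 12 (Mult (Var 12) (Add (Const 1) (Get 0 (Add (Const 1) (Var 17))))))
        (\<lambda>s. s 17 0 = i \<and> P (Suc i) (s(17 := (s 17)(0 := Suc i)))) s"
      unfolding upd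
      by (rule wp_Assign; unfold v) (use * part i in \<open>auto simp: P_def\<close>)
  qed (use that in \<open>simp add: upd fun_upd_other del: fun_upd_apply\<close>)
  show ?thesis
    unfolding compute_scale_def
  proof (rule wp_Seq, rule wp_Assign)
    show "val (Add (Const 1) (Var 10)) s < 2 ^ L" using part[of 0] assms(3) by (simp add: part_def)
    have "P 0 (s(12 := (s 12)(0 := Suc (buyers I))))"
      using assms blank_mono[of "{10, 11}" s "{10, 11, 12}"] by (simp add: P_def part_def)
    from loop[OF this] show "wp L X 1 (For 17 (Get 0 (Const 0))
      (Set 12 (Mult (Var 12) (Add (Const 1) (Get 0 (Add (Const 1) (Var 17)))))))
      (\<lambda>s. input s \<and> blank {10, 11, 12} s \<and> s 10 0 = buyers I \<and>
        s 11 0 = items I * types I div types I \<and> s 12 0 = market_scale I)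
      (s(12 := (s 12)(val (Const 0) s := val (Add (Const 1) (Var 10)) s)))"
      by (simp add: assms(3) P_def part_def market_scale_def)
  qed
qed

lemma wp_read_history:
  assumes "input s" "blank {10, 11, 12} s" "s 10 0 = buyers I" "s 11 0 = items I * types I div types I"
    "s 12 0 = market_scale I"
  shows "wp L X 1 read_history (\<lambda>s. ready s \<and> blank {10, 11, 12, 13, 14, 15, 16} s) s"
proof -
  define P where "P = (\<lambda>i s. input s \<and> blank {10, 11, 12, 13, 14, 15, 16} s \<and> s 10 0 = buyers I \<and>
    s 11 0 = items I * types I div types I \<and> s 12 0 = market_scale I \<and>
    (s 13 0, s 14 0, s 15, s 16) = observed (take i h))"
  have upd: "P i (s(17 := f)) = P i s" for i s f by (simp add: P_def)
  have start: "P 0 s"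
    using assms blank_mono[OF assms(2), of "{10, 11, 12, 13, 14, 15, 16}"]
    by (simp add: P_def) (simp add: blank_def)
  have "wp L X (Suc 0) read_history (P (length h)) s"
    unfolding read_history_def
  proof (rule wp_For)
    show "length h \<le> X" "length h < 2 ^ L" using X(5) less_L by auto
  next
    fix i s assume *: "P i s"
    then show "val (Quot (Get 1 (Const 0)) (Const 3)) s = length h"
      by (simp add: P_def input_def load_def length_encode_history)
    assume i: "s 17 0 = i" "i < length h"
    have cell: "val (history_cell j) s = encode_event (h ! i) ! j" if "j < 3" for j
      using * i load_history[OF i(2) that] by (simp add: history_cell_def P_def input_def add.commute)
    have less: "encode_event (h ! i) ! j < 2 ^ L" if "j < 3" for j
      using L(3) load_history[OF i(2) that] by metis
    obtain n c sold d where o: "observed (take i h) = (n, c, sold, d)" by (metis prod_cases4)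
    then have s: "s 13 0 = n" "s 14 0 = c" "s 15 = sold" "s 16 = d" using * by (auto simp: P_def)
    have n: "Suc n < 2 ^ L"
      using observed_arrivals_le[of "take i h"] i(2) o X(5) less_L by simp
    have snoc: "observed (take (Suc i) h) = observe (n, c, sold, d) (h ! i)"
      using i(2) by (simp add: take_Suc_conv_app_nth o)
    show "wp L X 0 (If (history_cell 0)
       (If (Monus (history_cell 0) (Const 1))
         (Assign 15 (history_cell 2) (Const 1))
         (Assign 16 (history_cell 2) (Var 13)))
       (Seq (Set 13 (Add (Var 13) (Const 1))) (Set 14 (history_cell 1))))
        (\<lambda>s. s 17 0 = i \<and> P (Suc i) (s(17 := (s 17)(0 := Suc i)))) s"
      unfolding upd
    proof (cases "h ! i")
      case (Arrives b)
      then have snoc': "observed (take (Suc i) h) = (Suc n, b, sold, d)" by (simp add: snoc)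
      have "val (history_cell 1) (s(13 := f)) = b" for f
        using cell[of 1] Arrives by (simp add: history_cell_def)
      then show "wp L X 0 (If (history_cell 0)
       (If (Monus (history_cell 0) (Const 1))
         (Assign 15 (history_cell 2) (Const 1))
         (Assign 16 (history_cell 2) (Var 13)))
       (Seq (Set 13 (Add (Var 13) (Const 1))) (Set 14 (history_cell 1))))
        (\<lambda>s. s 17 0 = i \<and> P (Suc i) s) s"
        using cell[of 0] Arrives * n s snoc' i less[of 1]
        by (intro wp_If wp_Seq wp_Assign) (simp_all add: P_def)
    next
      case (Shown a b l)
      then have snoc': "observed (take (Suc i) h) =
          (if l then (n, c, sold(a := 1), d) else (n, c, sold, d(a := n)))" by (simp add: snoc)
      from Shown show "wp L X 0 (If (history_cell 0)
       (If (Monus (history_cell 0) (Const 1))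
         (Assign 15 (history_cell 2) (Const 1))
         (Assign 16 (history_cell 2) (Var 13)))
       (Seq (Set 13 (Add (Var 13) (Const 1))) (Set 14 (history_cell 1))))
        (\<lambda>s. s 17 0 = i \<and> P (Suc i) s) s"
        using cell[of 0] cell[of 2] * n s snoc' i
        by (cases l; intro wp_If wp_Assign) (simp_all add: P_def)
    qed
  qed (use start in \<open>simp add: upd fun_upd_other del: fun_upd_apply\<close>)
  then show ?thesis unfolding One_nat_def
    by (rule wp_mono) (simp add: P_def ready_def input_def)
qed

text \<open>\<open>wp_Seq\<close> asks for a common nesting bound, so the shallow initial loops are
  lifted to the depth of the main loop.\<close>

lemma wp_depth_mono:
  assumes "wp L X d c Q s" "d \<le> d'"
  shows "wp L X d' c Q s"
proof -
  have "Suc X ^ d * k \<le> Suc X ^ d' * k" for k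
    using assms(2) by (intro mult_le_mono1 power_increasing) auto
  then show ?thesis using assms(1) le_trans unfolding wp_def by blast
qed

lemma wp_plan:
  assumes "input s" "blank {} s"
  shows "wp L X 4 plan_com (\<lambda>s. s 3 0 = encode_decision (plan I h)) s"
proof -
  obtain i c sold d where o: "observed h = (i, c, sold, d)" by (metis prod_cases4)
  have last: "wp L X 4 (Set 3 (Get 28 (Var 14))) (\<lambda>s. s 3 0 = encode_decision (plan I h)) s"
    if "ready s" "s 28 c = encode_decision (plan I h)" for s
  proof -
    have "s 14 0 = c" using that(1) o by (simp add: ready_def)
    then show ?thesis using that(2) selected_less by (intro wp_Assign) simp_all
  qed
  show ?thesis
    unfolding plan_com_def
    apply (rule wp_Seq, rule wp_mono[OF wp_depth_mono[OF wp_count_buyers[OF assms]]], simp, elim conjE)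
    apply (rule wp_Seq, rule wp_mono[OF wp_count_items], assumption+, elim conjE)
    apply (rule wp_Seq, rule wp_mono[OF wp_depth_mono[OF wp_compute_scale]], assumption+, simp, elim conjE)
    apply (rule wp_Seq, rule wp_mono[OF wp_depth_mono[OF wp_read_history]], assumption+, simp, elim conjE)
    apply (rule wp_Seq, rule wp_mono[OF wp_main[OF _ _ _ o]], assumption)
      apply (simp add: blank_def)
     apply (simp add: blank_def)
    apply (elim conjE)
    apply (rule last, assumption+)
    done
qed

end

section \<open>Polynomial running time\<close>

lemma wp_exec:
  assumes "wp L X d c Q s" "bounded_store L s"
  obtains t s' where "exec c s t s'" "t \<le> Suc X ^ d * (com_weight c * L)" "Q s'"
  using assms unfolding wp_def by blast

lemma bits_pos: "0 < bits x"
  by (simp add: bits_def)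

lemma less_bits: "x < 2 ^ bits x"
  using less_power_bits[of x] by (auto simp: bits_def)

lemma length_le_encoding_size: "length xs \<le> encoding_size xs"
proof (induction xs)
  case (Cons x xs)
  then show ?case using bits_pos[of x] by (simp add: encoding_size_def)
qed simp

lemma elem_less_encoding_size:
  assumes "x \<in> set xs"
  shows "x < 2 ^ encoding_size xs"
proof -
  have "bits x \<le> encoding_size xs"
    using assms by (auto simp: encoding_size_def intro: member_le_sum_list)
  then have "(2::nat) ^ bits x \<le> 2 ^ encoding_size xs" by (intro power_increasing) auto
  with less_bits show ?thesis by (rule less_le_trans)
qed

lemma load_less: "load xs i < 2 ^ encoding_size xs"
proof -
  have "length xs < 2 ^ encoding_size xs"
    using length_le_encoding_size[of xs] less_exp[of "encoding_size xs"] by linarith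
  then show ?thesis by (auto simp: load_def elem_less_encoding_size)
qed

lemma prod_list_le: "(\<Prod>x\<leftarrow>xs. 1 + x) \<le> 2 ^ encoding_size xs"
proof (induction xs)
  case (Cons x xs)
  have "1 + x \<le> 2 ^ bits x" using less_bits[of x] by simp
  with Cons show ?case by (simp add: encoding_size_def power_add mult_le_mono del: mult_Suc)
qed (simp add: encoding_size_def)

text \<open>The number of buyers counts in unary in \<open>market_size\<close>, and
  \<open>1 + x\<close> is at most \<open>2 ^ bits x\<close> for each encoded number.\<close>

lemma scale_le: "market_scale I \<le> 2 ^ market_size I"
proof -
  have "1 + buyers I \<le> 2 ^ buyers I" using Suc_leI[OF less_exp[of "buyers I"]] by simp
  then have "market_scale I \<le> 2 ^ buyers I * 2 ^ encoding_size (encode_market I)"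
    unfolding market_scale_def by (intro mult_le_mono prod_list_le)
  then show ?thesis by (simp add: market_size_def add.commute flip: power_add)
qed

lemma poly_time_plan: "poly_time (\<lambda>I r. plan I) 0"
proof -
  \<comment> \<open>The bound of \<open>wp\<close> as a polynomial in the input size
    \<open>S\<close>: \<open>Suc X\<close> is \<open>S + 2\<close>, and \<open>L\<close> is
    \<open>12 * S + 12\<close>.\<close>
  define T :: "nat poly" where "T = [:2, 1:] ^ 4 * ([:com_weight plan_com:] * [:12, 12:])"
  have "\<exists>t s. exec plan_com (input_store I r h) t s \<and>
      t \<le> poly T (market_size I + encoding_size (encode_history h)) \<and> s 3 0 = encode_decision (plan I h)"
    if valid: "valid_market I" and r: "length r = poly 0 (market_size I)" for I r h
  proof -
    define S where "S = market_size I + encoding_size (encode_history h)"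
    define X where "X = Suc S"
    \<comment> \<open>Eleven times \<open>S\<close> bits suffice for the bound on
      \<open>market_scale I ^ 11\<close>; taking 12 and \<open>Suc S\<close> makes the inequality
      strict and leaves room for all other numbers.\<close>
    define L where "L = 12 * X"
    have enc: "length (encode_market I) \<le> S"
      using length_le_encoding_size[of "encode_market I"] by (simp add: S_def market_size_def)
    have less: "x < 2 ^ L" if "x < 2 ^ S" for x :: nat
    proof -
      have "(2::nat) ^ S \<le> 2 ^ L" by (intro power_increasing) (auto simp: L_def X_def)
      with that show ?thesis by (rule less_le_trans)
    qed
    have load_market: "load (encode_market I) i < 2 ^ L" for i
    proof (rule less)
      have "load (encode_market I) i < 2 ^ encoding_size (encode_market I)" by (rule load_less)
      also have "\<dots> \<le> 2 ^ S" by (intro power_increasing) (auto simp: S_def market_size_def)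
      finally show "load (encode_market I) i < 2 ^ S" .
    qed
    have load_history: "load (encode_history h) i < 2 ^ L" for i
    proof (rule less)
      have "load (encode_history h) i < 2 ^ encoding_size (encode_history h)" by (rule load_less)
      also have "\<dots> \<le> 2 ^ S" by (intro power_increasing) (auto simp: S_def)
      finally show "load (encode_history h) i < 2 ^ S" .
    qed
    interpret plan_program I h X L
    proof
      show "valid_market I" by (rule valid)
      show "types I \<le> X" "length (encode_market I) \<le> X" using enc by (simp_all add: length_encode_market X_def)
      show "items I * types I div types I \<le> X"
      proof (cases "types I = 0")
        case False
        then have "items I \<le> types I * items I" by simp
        also have "\<dots> \<le> X" using enc by (simp add: length_encode_market X_def)
        finally show ?thesis using False by simp
      qed simp
      show "Suc (buyers I) \<le> X" by (simp add: X_def S_def market_size_def)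
      show "length h \<le> X"
        using length_le_encoding_size[of "encode_history h"] by (simp add: X_def S_def length_encode_history)
      show "market_scale I ^ 11 < 2 ^ L"
      proof -
        have "(2::nat) ^ market_size I \<le> 2 ^ S" by (intro power_increasing) (auto simp: S_def)
        with scale_le have "market_scale I \<le> 2 ^ S" by (rule le_trans)
        then have "market_scale I ^ 11 \<le> (2 ^ S) ^ 11" by (rule power_mono) simp
        also have "\<dots> = 2 ^ (11 * S)" by (metis mult.commute power_mult)
        also have "\<dots> < (2::nat) ^ L" by (intro power_strict_increasing) (auto simp: L_def X_def)
        finally show ?thesis .
      qed
      show "X < 2 ^ L"
      proof -
        have "X < 2 ^ X" by (rule less_exp)
        also have "\<dots> \<le> (2::nat) ^ L" by (intro power_increasing) (auto simp: L_def)
        finally show ?thesis .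
      qed
      show "load (encode_history h) i < 2 ^ L" for i by (rule load_history)
    qed
    \<comment> \<open>The zero polynomial allots no random bits, so \<open>r\<close> is empty and
      array 2 starts out zero.\<close>
    have r0: "load (map of_bool r) = (\<lambda>_. 0)" using r by (auto simp: load_def)
    have "0 < L" by (simp add: L_def X_def)
    then have "bounded_store L (input_store I r h)"
      using load_market load_history by (auto simp: bounded_store_def input_store_def r0)
    moreover have "wp L X 4 plan_com (\<lambda>s. s 3 0 = encode_decision (plan I h)) (input_store I r h)"
      by (rule wp_plan) (auto simp: input_def blank_def input_store_def r0)
    ultimately obtain t s where "exec plan_com (input_store I r h) t s"
        "t \<le> Suc X ^ 4 * (com_weight plan_com * L)" "s 3 0 = encode_decision (plan I h)"
      by (elim wp_exec)
    moreover have "Suc X ^ 4 * (com_weight plan_com * L) = poly T S"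
      by (simp add: T_def X_def L_def poly_power distrib_left mult_ac)
    ultimately show ?thesis by (auto simp: S_def)
  qed
  then show ?thesis unfolding poly_time_def by blast
qed

theorem theorem4:
  shows "\<exists>(\<sigma> :: online_algorithm) (q :: nat poly).
           poly_time \<sigma> q \<and>
           (\<forall>(I :: market) (D :: strategy pmf). valid_market I \<longrightarrow>
              expected_revenue I (randomized_strategy \<sigma> q I) \<ge> 1 / 7.92 * expected_revenue I D)"
proof (intro exI conjI allI impI)
  show "poly_time (\<lambda>I r. plan I) 0" by (rule poly_time_plan)
next
  fix I :: market and D :: "strategy pmf"
  assume valid: "valid_market I"
  have "expected_revenue I (randomized_strategy (\<lambda>I r. plan I) 0 I) =
      measure_pmf.expectation (run I (plan I) (buyers I)) (revenue I)"
    by (simp add: expected_revenue_def randomized_strategy_def bind_return_pmf)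
  moreover have "expected_revenue I D \<le>
      7.92 * measure_pmf.expectation (run I (plan I) (buyers I)) (revenue I)"
    by (rule expected_revenue_le[OF valid strategy_vs_plan[OF valid]])
  ultimately show "expected_revenue I (randomized_strategy (\<lambda>I r. plan I) 0 I) \<ge> 1 / 7.92 * expected_revenue I D"
    by simp
qed

end
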